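(* There exist absolute constants $c, C > 0$ such that the following holds. Let $1 \le k \le d$ be integers and $\alpha \in (0,1/2)$. If $M$ is an $(\varepsilon,\delta)$-pan-private online algorithm that learns width-$k$ signed parities with error $\alpha$ and sample complexity $n$, and $\delta \log\big(\binom{d}{\le k}/\delta\big) \le c\, \alpha^2 \varepsilon^2 / \binom{d}{\le k}$, then $n \ge C \sqrt{\binom{d}{\le k}}/(\alpha \varepsilon)$.
   Context: Notation: $\binom{d}{\le k} = \sum_{j=1}^{k} \binom{d}{j}$ and $[d]=\{1,\dots,d\}$. Data domain $\mathcal{X} = \{\pm 1\}^{d+1}$, where coordinate $d+1$ is interpreted as a label. For $\ell \subseteq [d]$, $b \in \{\pm1\}$ and a distribution $\mathbf{P}$ on $\mathcal{X}$, let $\mathrm{err}_{\mathbf{P}}(\ell,b) = \Pr_{X \sim \mathbf{P}}[\, b \prod_{j \in \ell} X_j \ne X_{d+1}]$. An algorithm learns width-$k$ signed parities with error $\alpha$ and sample complexity $n$ if, for every distribution $\mathbf{P}$ over $\mathcal{X}$, given $n$ i.i.d. samples from $\mathbf{P}$ it outputs $(L,B) \in 2^{[d]} \times \{\pm 1\}$ such that, with probability at least $99/100$ (over the samples and the algorithm's randomness), $\mathrm{err}_{\mathbf{P}}(L,B) < \min_{\ell,b} \mathrm{err}_{\mathbf{P}}(\ell,b) + \alpha$. Pan-privacy: An online algorithm $M$ on streams $\vec x = (x_1,\dots,x_n) \in \mathcal{X}^n$ consists of randomized maps $M_1 : \mathcal{X} \to \mathcal{I}$, $M_i : \mathcal{X}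 \times \mathcal{I} \to \mathcal{I}$ for $i \ge 2$, and an output map $M_{\mathcal{O}} : \mathcal{I} \to \mathcal{O}$; it computes states $s_1 = M_1(x_1)$, $s_i = M_i(x_i, s_{i-1})$. Let $M_{\mathcal{I}}(\vec x)$ be the internal state after processing $\vec x$ and $\vec x_{\le t}$ the first $t$ elements; the output is $M(\vec x) = M_{\mathcal{O}}(M_{\mathcal{I}}(\vec x))$. Streams are neighbors if they differ in at most one element. $M$ is $(\varepsilon,\delta)$-pan-private if for every pair of neighboring streams $\vec x, \vec x'$, every time $t$ and every set $T \subseteq \mathcal{I} \times \mathcal{O}$, $\Pr[(M_{\mathcal{I}}(\vec x_{\le t}), M_{\mathcal{O}}(M_{\mathcal{I}}(\vec x))) \in T] \le e^{\varepsilon} \Pr[(M_{\mathcal{I}}(\vec x'_{\le t}), M_{\mathcal{O}}(M_{\mathcal{I}}(\vec x'))) \in T] + \delta$, where the state at time $t$ and the final output come from the same run. A pan-private algorithm "learns" if its output $M(\vec x)$ on a stream of $n$ samples meets the accuracy requirement.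
   Formalization: The formal theorem assumes ε ≤ 1 and 0 ≤ δ ≤ 1/2; the claim fails for unbounded ε (randomized response, ε = 2d+10, k = d) and for δ near 1 (d = k = 1). Formally c, C follow the choice of the type of internal states; real-valued states suffice. *)

theory Defs
  imports "HOL-Probability.Probability"
begin

section \<open>Signed parities\<close>

definition binom_le :: "nat \<Rightarrow> nat \<Rightarrow> nat" where
  "binom_le d k = (\<Sum>j=1..k. d choose j)"

text \<open>Points are extensional functions on the coordinates \<open>1, \<dots>, d + 1\<close>; coordinate
  \<open>d + 1\<close> is the label.\<close>

definition data_domain :: "nat \<Rightarrow> (nat \<Rightarrow> int) set" where
  "data_domain d = {1..d+1} \<rightarrow>\<^sub>E {-1, 1}"

definition signed_parities :: "nat \<Rightarrow> (nat set \<times> int) set" where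
  "signed_parities d = Pow {1..d} \<times> {-1, 1}"

definition parity_err :: "nat \<Rightarrow> (nat \<Rightarrow> int) pmf \<Rightarrow> nat set \<times> int \<Rightarrow> real" where
  "parity_err d P = (\<lambda>(l, b). measure_pmf.prob P {x. b * (\<Prod>j\<in>l. x j) \<noteq> x (d+1)})"

text \<open>The benchmark is the best parity of width at most \<open>k\<close>; the learner itself may output
  a signed parity of any width.\<close>

definition opt_err :: "nat \<Rightarrow> nat \<Rightarrow> (nat \<Rightarrow> int) pmf \<Rightarrow> real" where
  "opt_err d k P = Min (parity_err d P ` {(l, b) \<in> signed_parities d. card l \<le> k})"

text \<open>An algorithm is given by its output distribution on each dataset. The integral below is
  the success probability over both the i.i.d. sample and the algorithm's randomness.\<close>

definition learns_parities ::
  "nat \<Rightarrow> nat \<Rightarrow> real \<Rightarrow> nat \<Rightarrow> ((nat \<Rightarrow> int) list \<Rightarrow> (nat set \<times> int) measure) \<Rightarrow> bool" where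
  "learns_parities d k \<alpha> n A \<longleftrightarrow>
     (\<forall>P. set_pmf P \<subseteq> data_domain d \<longrightarrow>
        measure_pmf.expectation (replicate_pmf n P)
          (\<lambda>xs. measure (A xs) {h \<in> signed_parities d. parity_err d P h < opt_err d k P + \<alpha>})
        \<ge> 99 / 100)"


section \<open>Online algorithms and pan-privacy\<close>

text \<open>Randomized maps are Markov kernels, so that internal states may live in an arbitrary
  measurable space \<open>S\<close> and outputs in an arbitrary measurable space \<open>Q\<close>; stream elements are
  treated as discrete. The value of \<open>step_map M i\<close> is relevant only for \<open>i \<ge> 2\<close>.\<close>

record ('x, 's, 'o) online_alg =
  init_map :: "'x \<Rightarrow> 's measure"
  step_map :: "nat \<Rightarrow> 'x \<Rightarrow> 's \<Rightarrow> 's measure"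
  out_map :: "'s \<Rightarrow> 'o measure"

definition online_algorithm ::
  "'x set \<Rightarrow> 's measure \<Rightarrow> 'o measure \<Rightarrow> ('x, 's, 'o) online_alg \<Rightarrow> bool" where
  "online_algorithm X S Q M \<longleftrightarrow>
     (\<forall>x\<in>X. init_map M x \<in> space (prob_algebra S)) \<and>
     (\<forall>i\<ge>2. \<forall>x\<in>X. step_map M i x \<in> S \<rightarrow>\<^sub>M prob_algebra S) \<and>
     out_map M \<in> S \<rightarrow>\<^sub>M prob_algebra Q"

text \<open>\<open>process S M i xs s\<close> is the law of the state reached from state \<open>s\<close> when \<open>xs\<close> are the
  stream elements number \<open>i, i + 1, \<dots>\<close>.\<close>

primrec process ::
  "'s measure \<Rightarrow> ('x, 's, 'o) online_alg \<Rightarrow> nat \<Rightarrow> 'x list \<Rightarrow> 's \<Rightarrow> 's measure" where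
  "process S M i [] s = return S s"
| "process S M i (x # xs) s = step_map M i x s \<bind> process S M (Suc i) xs"

text \<open>Only meaningful for nonempty streams.\<close>

definition internal_state :: "'s measure \<Rightarrow> ('x, 's, 'o) online_alg \<Rightarrow> 'x list \<Rightarrow> 's measure" where
  "internal_state S M xs = init_map M (hd xs) \<bind> process S M 2 (tl xs)"

definition alg_output :: "'s measure \<Rightarrow> ('x, 's, 'o) online_alg \<Rightarrow> 'x list \<Rightarrow> 'o measure" where
  "alg_output S M xs = internal_state S M xs \<bind> out_map M"

text \<open>Joint law of the state after \<open>t\<close> elements and the final output, within one run.\<close>

definition state_and_output ::
  "'s measure \<Rightarrow> 'o measure \<Rightarrow> ('x, 's, 'o) online_alg \<Rightarrow> 'x list \<Rightarrow> nat \<Rightarrow> ('s \<times> 'o) measure" where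
  "state_and_output S Q M xs t =
     internal_state S M (take t xs) \<bind> (\<lambda>s.
     process S M (Suc t) (drop t xs) s \<bind> (\<lambda>s'.
     out_map M s' \<bind> (\<lambda>y. return (S \<Otimes>\<^sub>M Q) (s, y))))"

definition neighbors :: "'x list \<Rightarrow> 'x list \<Rightarrow> bool" where
  "neighbors xs ys \<longleftrightarrow> length xs = length ys \<and> card {i. i < length xs \<and> xs ! i \<noteq> ys ! i} \<le> 1"

definition pan_private ::
  "'x set \<Rightarrow> 's measure \<Rightarrow> 'o measure \<Rightarrow> nat \<Rightarrow> real \<Rightarrow> real \<Rightarrow> ('x, 's, 'o) online_alg \<Rightarrow> bool" where
  "pan_private X S Q n \<epsilon> \<delta> M \<longleftrightarrow>
     (\<forall>xs ys t T. length xs = n \<and> set xs \<subseteq> X \<and> set ys \<subseteq> X \<and> neighbors xs ys \<and>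
        t \<in> {1..n} \<and> T \<in> sets (S \<Otimes>\<^sub>M Q) \<longrightarrow>
        measure (state_and_output S Q M xs t) T
          \<le> exp \<epsilon> * measure (state_and_output S Q M ys t) T + \<delta>)"

end

theory Submission
  imports Defs
begin

text \<open>Only the internal state is used. Let \<open>P\<^sub>v\<close> be the distribution that is biased by \<open>\<alpha>\<close> towards the
  signed parity \<open>v = (l, b)\<close>, let \<open>U\<close> be uniform, and replace the elements of a stream drawn from
  \<open>P\<^sub>v\<close> by elements drawn from \<open>U\<close>, starting with the first one. When element number \<open>t\<close> is replaced,
  the prefix no longer depends on \<open>v\<close>, so the state after \<open>t\<close> elements is a fixed
  \<open>(\<epsilon>, \<delta>)\<close>-differentially private function of that single element, and everything later is
  post-processing. By orthogonality of the parities, such a local randomizer distinguishes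
  \<open>P\<^sub>v\<close> from \<open>U\<close> with advantage only \<open>O(\<alpha> (\<epsilon> / \<surd>K + \<delta>))\<close> on average over the \<open>2 K\<close> choices of \<open>v\<close>.
  A learner must output \<open>v\<close> on \<open>P\<^sub>v\<close> but cannot do so on \<open>U\<close>, so these \<open>n\<close> advantages sum to a
  constant.\<close>

section \<open>Local randomizers and orthogonal characters\<close>

text \<open>Up to 1/m, a test function with values in [0, 1] is the average of the indicators of its
  superlevel sets at 1/m, ..., m/m. The inequality for events holds for each of these sets, and
  averaging keeps the additive term at \<delta> instead of adding it up m times.\<close>

lemma dp_integral_le:
  fixes f :: "'s \<Rightarrow> real"
  assumes "prob_space \<mu>" "prob_space \<nu>" and sets_eq: "sets \<nu> = sets \<mu>"
    and dp: "\<And>T. T \<in> sets \<mu> \<Longrightarrow> measure \<mu> T \<le> e * measure \<nu> T + \<delta>" and "0 \<le> e"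
    and f [measurable]: "f \<in> borel_measurable \<mu>" and f01: "\<And>s. s \<in> space \<mu> \<Longrightarrow> 0 \<le> f s \<and> f s \<le> 1"
  shows "(\<integral>s. f s \<partial>\<mu>) \<le> e * (\<integral>s. f s \<partial>\<nu>) + \<delta>"
proof -
  interpret \<mu>: prob_space \<mu> by fact
  interpret \<nu>: prob_space \<nu> by fact
  note [measurable_cong] = sets_eq
  have space_eq: "space \<nu> = space \<mu>" using sets_eq by (rule sets_eq_imp_space_eq)
  have ff: "f \<in> borel_measurable \<nu>" by measurable
  have int: "integrable \<mu> f" "integrable \<nu> f"
    using f01 f ff space_eq by (auto intro!: \<mu>.integrable_const_bound[of _ 1] \<nu>.integrable_const_bound[of _ 1])
  have key: "(\<integral>s. f s \<partial>\<mu>) \<le> e * (\<integral>s. f s \<partial>\<nu>) + \<delta> + 1 / real m" if m: "0 < m" for m :: nat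
  proof -
    \<comment> \<open>\<open>h\<close> rounds \<open>f\<close> down to a multiple of \<open>1 / m\<close>\<close>
    define T where "T j = {s \<in> space \<mu>. real j / real m \<le> f s}" for j :: nat
    define h where "h s = (\<Sum>j=1..m. indicator (T j) s) / real m" for s
    have T [measurable]: "T j \<in> sets \<mu>" for j unfolding T_def by measurable
    have T' : "T j \<in> sets \<nu>" for j using T sets_eq by simp
    have h_eq: "h s = real (nat \<lfloor>m * f s\<rfloor>) / real m" if s: "s \<in> space \<mu>" for s
    proof -
      have "(\<Sum>j=1..m. indicator (T j) s :: real) = (\<Sum>j=1..m. if real j \<le> m * f s then 1 else 0)"
        using s m by (intro sum.cong) (auto simp: T_def indicator_def field_simps)
      \<comment> \<open>The level j runs only up to m; since \<open>f s \<le> 1\<close>, this bound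
        cuts nothing off and the count is a floor.\<close>
      also have "\<dots> = real (card {j\<in>{1..m}. real j \<le> m * f s})"
        by (simp add: sum.If_cases Int_def)
      also have "{j\<in>{1..m}. real j \<le> m * f s} = {1..nat \<lfloor>m * f s\<rfloor>}"
      proof -
        have "m * f s \<le> m" using f01[OF s] m by (simp add: mult_le_cancel_left1)
        moreover have "0 \<le> m * f s" using f01[OF s] by simp
        ultimately show ?thesis
          by (auto simp: le_nat_iff le_floor_iff nat_le_iff)
      qed
      finally show ?thesis by (simp add: h_def)
    qed
    have h_bounds: "h s \<le> f s" "f s \<le> h s + 1 / m" if s: "s \<in> space \<mu>" for s
    proof -
      have "0 \<le> m * f s" using f01[OF s] by simp
      then have "real (nat \<lfloor>m * f s\<rfloor>) \<le> m * f s" "m * f s \<le> real (nat \<lfloor>m * f s\<rfloor>) + 1"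
        by linarith+
      then show "h s \<le> f s" "f s \<le> h s + 1 / m"
        using m by (auto simp: h_eq[OF s] field_simps)
    qed
    have int_h: "integrable \<mu> h" "integrable \<nu> h"
      unfolding h_def using T T' by (auto intro!: Bochner_Integration.integrable_sum integrable_divide
        integrable_real_indicator simp: \<mu>.emeasure_eq_measure \<nu>.emeasure_eq_measure)
    have h_int: "(\<integral>s. h s \<partial>\<mu>) = (\<Sum>j=1..m. measure \<mu> (T j)) / m"
      "(\<integral>s. h s \<partial>\<nu>) = (\<Sum>j=1..m. measure \<nu> (T j)) / m"
      unfolding h_def using T T' sets.sets_into_space
      by (subst integral_divide_zero Bochner_Integration.integral_sum;
          auto simp: \<mu>.emeasure_eq_measure \<nu>.emeasure_eq_measure T_def space_eq intro!: sum.cong arg_cong[where f="measure _"])+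
    have "(\<integral>s. f s \<partial>\<mu>) \<le> (\<integral>s. h s + 1 / m \<partial>\<mu>)"
      using int int_h h_bounds by (intro integral_mono) auto
    also have "\<dots> = (\<integral>s. h s \<partial>\<mu>) + 1 / m"
      using int_h by (subst Bochner_Integration.integral_add) (auto simp: \<mu>.prob_space)
    also have "(\<integral>s. h s \<partial>\<mu>) \<le> (\<Sum>j=1..m. e * measure \<nu> (T j) + \<delta>) / m"
      unfolding h_int by (intro divide_right_mono sum_mono dp T) auto
    also have "\<dots> = e * (\<integral>s. h s \<partial>\<nu>) + \<delta>"
      unfolding h_int using m by (simp add: sum.distrib sum_distrib_left add_divide_distrib)
    also have "(\<integral>s. h s \<partial>\<nu>) \<le> (\<integral>s. f s \<partial>\<nu>)"
      using int int_h h_bounds space_eq by (intro integral_mono) auto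
    finally show ?thesis using \<open>0 \<le> e\<close> by (simp add: mult_left_mono)
  qed
  show ?thesis
  proof (rule field_le_epsilon)
    fix r :: real assume "0 < r"
    then obtain m :: nat where m: "0 < m" "inverse (real m) < r"
      using reals_Archimedean by (metis zero_less_Suc)
    then show "(\<integral>s. f s \<partial>\<mu>) \<le> e * (\<integral>s. f s \<partial>\<nu>) + \<delta> + r"
      using key[of m] by (simp add: inverse_eq_divide)
  qed
qed

text \<open>Parseval's identity: after expanding the square, only the diagonal terms
  survive.\<close>

lemma sum_square_orthogonal:
  fixes w :: "'l \<Rightarrow> 'x \<Rightarrow> real"
  assumes "finite L"
    and orth: "\<And>l l'. l \<in> L \<Longrightarrow> l' \<in> L \<Longrightarrow>
      (\<Sum>x\<in>X. w l x * w l' x) = (if l = l' then real (card X) else 0)"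
  shows "(\<Sum>x\<in>X. (\<Sum>l\<in>L. w l x * c l)\<^sup>2) = real (card X) * (\<Sum>l\<in>L. (c l)\<^sup>2)"
proof -
  have "(\<Sum>x\<in>X. (\<Sum>l\<in>L. w l x * c l)\<^sup>2)
      = (\<Sum>x\<in>X. \<Sum>l\<in>L. \<Sum>l'\<in>L. c l * c l' * (w l x * w l' x))"
    by (simp add: power2_eq_square sum_product mult_ac)
  also have "\<dots> = (\<Sum>l\<in>L. \<Sum>x\<in>X. \<Sum>l'\<in>L. c l * c l' * (w l x * w l' x))"
    by (rule sum.swap)
  also have "\<dots> = (\<Sum>l\<in>L. \<Sum>l'\<in>L. \<Sum>x\<in>X. c l * c l' * (w l x * w l' x))"
    by (intro sum.cong refl sum.swap)
  also have "\<dots> = (\<Sum>l\<in>L. \<Sum>l'\<in>L. c l * c l' * (if l = l' then real (card X) else 0))"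
    by (intro sum.cong refl) (simp add: orth flip: sum_distrib_left)
  also have "\<dots> = (\<Sum>l\<in>L. c l * c l * real (card X))"
    using \<open>finite L\<close> by (intro sum.cong refl) (simp add: if_distrib cong: if_cong)
  finally show ?thesis
    by (simp add: power2_eq_square sum_distrib_left mult_ac)
qed

text \<open>Cauchy-Schwarz against the constant 1 turns Parseval's identity into an L1 bound. The
  gain from \<open>card L\<close> to its square root is the source of the square root in the sample
  bound.\<close>

lemma sum_abs_orthogonal_le:
  fixes w :: "'l \<Rightarrow> 'x \<Rightarrow> real"
  assumes "finite L"
    and orth: "\<And>l l'. l \<in> L \<Longrightarrow> l' \<in> L \<Longrightarrow>
      (\<Sum>x\<in>X. w l x * w l' x) = (if l = l' then real (card X) else 0)"
    and c: "\<And>l. l \<in> L \<Longrightarrow> \<bar>c l\<bar> \<le> 1"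
  shows "(\<Sum>x\<in>X. \<bar>\<Sum>l\<in>L. w l x * c l\<bar>) \<le> real (card X) * sqrt (real (card L))"
proof (rule power2_le_imp_le)
  have c2: "(\<Sum>l\<in>L. (c l)\<^sup>2) \<le> (\<Sum>l\<in>L. 1)"
    using c by (intro sum_mono) (simp add: abs_square_le_1)
  have "(\<Sum>x\<in>X. \<bar>\<Sum>l\<in>L. w l x * c l\<bar>)\<^sup>2
      \<le> (\<Sum>x\<in>X. 1\<^sup>2) * (\<Sum>x\<in>X. \<bar>\<Sum>l\<in>L. w l x * c l\<bar>\<^sup>2)"
    using Cauchy_Schwarz_ineq_sum[of "\<lambda>_. 1" "\<lambda>x. \<bar>\<Sum>l\<in>L. w l x * c l\<bar>" X] by simp
  also have "\<dots> = real (card X) * (real (card X) * (\<Sum>l\<in>L. (c l)\<^sup>2))"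
    using sum_square_orthogonal[OF assms(1) orth, of c] by simp
  also have "\<dots> \<le> real (card X) * (real (card X) * real (card L))"
    using c2 by (intro mult_left_mono) auto
  finally show "(\<Sum>x\<in>X. \<bar>\<Sum>l\<in>L. w l x * c l\<bar>)\<^sup>2 \<le> (real (card X) * sqrt (real (card L)))\<^sup>2"
    by (simp add: power_mult_distrib power2_eq_square mult_ac)
qed auto

text \<open>Since the characters \<open>w l\<close> have mean zero, \<open>G x s = (\<Sum>l\<in>L. w l x * h l s)\<close> sums to zero over \<open>x\<close>.
  Privacy moves each integral of \<open>G x\<close> from \<open>K x\<close> to one reference law \<open>K y\<close>, where the main terms
  cancel; this avoids densities, which need not be bounded when \<open>\<delta> > 0\<close>.\<close>

lemma local_randomizer_correlation_le:
  fixes w :: "'l \<Rightarrow> 'x \<Rightarrow> real" and h :: "'l \<Rightarrow> 's \<Rightarrow> real" and K :: "'x \<Rightarrow> 's measure"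
  assumes "finite X" "X \<noteq> {}" "finite L"
    and orth: "\<And>l l'. l \<in> L \<Longrightarrow> l' \<in> L \<Longrightarrow>
      (\<Sum>x\<in>X. w l x * w l' x) = (if l = l' then real (card X) else 0)"
    and mean: "\<And>l. l \<in> L \<Longrightarrow> (\<Sum>x\<in>X. w l x) = 0"
    and w: "\<And>l x. l \<in> L \<Longrightarrow> x \<in> X \<Longrightarrow> \<bar>w l x\<bar> \<le> 1"
    and K: "\<And>x. x \<in> X \<Longrightarrow> K x \<in> space (prob_algebra S)"
    and dp: "\<And>x y T. x \<in> X \<Longrightarrow> y \<in> X \<Longrightarrow> T \<in> sets S \<Longrightarrow>
      measure (K x) T \<le> exp \<epsilon> * measure (K y) T + \<delta>"
    and "0 \<le> \<epsilon>" "0 \<le> \<delta>"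
    and h [measurable]: "\<And>l. l \<in> L \<Longrightarrow> h l \<in> borel_measurable S"
    and h1: "\<And>l s. l \<in> L \<Longrightarrow> s \<in> space S \<Longrightarrow> \<bar>h l s\<bar> \<le> 1"
  shows "(\<Sum>x\<in>X. \<Sum>l\<in>L. w l x * (\<integral>s. h l s \<partial>K x))
    \<le> real (card X) * ((exp \<epsilon> - exp (- \<epsilon>)) / 2 * sqrt (real (card L)) + 2 * \<delta> * real (card L))"
proof (cases "L = {}")
  case False
  \<comment> \<open>Dividing by \<open>card L\<close> brings the positive and negative parts of
    \<open>G x\<close> into [0, 1], the range that \<open>dp_integral_le\<close> asks for.\<close>
  define k where "k = real (card L)"
  have k: "0 < k" using False \<open>finite L\<close> by (simp add: k_def card_gt_0_iff)
  define G where "G x s = (\<Sum>l\<in>L. w l x * h l s)" for x s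
  define p where "p x s = max 0 (G x s) / k" for x s
  define q where "q x s = max 0 (- G x s) / k" for x s
  have G_meas [measurable]: "G x \<in> borel_measurable S" for x
    unfolding G_def by measurable
  have pq_meas [measurable]: "p x \<in> borel_measurable S" "q x \<in> borel_measurable S" for x
    unfolding p_def q_def by measurable
  have G_le: "\<bar>G x s\<bar> \<le> k" if "x \<in> X" "s \<in> space S" for x s
  proof -
    have "\<bar>G x s\<bar> \<le> (\<Sum>l\<in>L. \<bar>w l x * h l s\<bar>)"
      unfolding G_def by (rule sum_abs)
    also have "\<dots> \<le> (\<Sum>l\<in>L. 1)"
      using w h1 that by (intro sum_mono) (simp add: abs_mult mult_le_one)
    finally show ?thesis by (simp add: k_def)
  qed
  have p01: "0 \<le> p x s \<and> p x s \<le> 1" and q01: "0 \<le> q x s \<and> q x s \<le> 1" if "x \<in> X" "s \<in> space S" for x s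
    using G_le[OF that] k by (auto simp: p_def q_def)
  have Kx: "prob_space (K x)" "sets (K x) = sets S" "space (K x) = space S" if "x \<in> X" for x
    using K[OF that] by (auto simp: space_prob_algebra dest: sets_eq_imp_space_eq)
  have G_eq: "G x s = k * p x s - k * q x s" for x s
    using k by (simp add: p_def q_def max_def)
  obtain y where y: "y \<in> X" using \<open>X \<noteq> {}\<close> by blast
  have integ: "integrable (K x) f"
    if "x \<in> X" "f \<in> borel_measurable S" "\<And>s. s \<in> space S \<Longrightarrow> \<bar>f s\<bar> \<le> B" for x B and f :: "'s \<Rightarrow> real"
  proof -
    interpret prob_space "K x" using Kx that by blast
    show ?thesis using that(2,3) Kx(3)[OF that(1)] measurable_cong_sets[OF Kx(2)[OF that(1)] refl, of borel]
      by (intro integrable_const_bound[of _ B]) auto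
  qed
  have int_pq: "integrable (K z) (p x)" "integrable (K z) (q x)" if "x \<in> X" "z \<in> X" for x z
    using p01[OF that(1)] q01[OF that(1)] that(2)
    by (auto intro!: integ[of z _ 1])
  have meas_K: "f \<in> borel_measurable (K x)" if "x \<in> X" "f \<in> borel_measurable S" for x and f :: "'s \<Rightarrow> real"
    using that measurable_cong_sets[OF Kx(2)[OF that(1)] refl, of borel] by auto
  have step: "(\<Sum>l\<in>L. w l x * (\<integral>s. h l s \<partial>K x))
      \<le> k * (\<integral>s. exp \<epsilon> * p x s - exp (- \<epsilon>) * q x s \<partial>K y) + k * (2 * \<delta>)" if x: "x \<in> X" for x
  proof -
    have "(\<Sum>l\<in>L. w l x * (\<integral>s. h l s \<partial>K x)) = (\<integral>s. G x s \<partial>K x)"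
      unfolding G_def using x h h1
      by (subst Bochner_Integration.integral_sum) (auto intro!: integrable_mult_right integ[of _ _ 1])
    also have "\<dots> = k * (\<integral>s. p x s \<partial>K x) - k * (\<integral>s. q x s \<partial>K x)"
      unfolding G_eq using int_pq[OF x x] by simp
    finally have "(\<Sum>l\<in>L. w l x * (\<integral>s. h l s \<partial>K x))
      = k * ((\<integral>s. p x s \<partial>K x) - (\<integral>s. q x s \<partial>K x))"
      by (simp add: right_diff_distrib)
    moreover have "(\<integral>s. p x s \<partial>K x) \<le> exp \<epsilon> * (\<integral>s. p x s \<partial>K y) + \<delta>"
      using p01[OF x] x y Kx dp by (intro dp_integral_le meas_K) auto
    \<comment> \<open>\<open>q\<close> enters with a minus sign and needs a lower bound, so privacy
      is used in the other direction, from \<open>K y\<close> to \<open>K x\<close>.\<close>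
    moreover have "(\<integral>s. q x s \<partial>K x) \<ge> exp (- \<epsilon>) * (\<integral>s. q x s \<partial>K y) - \<delta>"
    proof -
      have "(\<integral>s. q x s \<partial>K y) \<le> exp \<epsilon> * (\<integral>s. q x s \<partial>K x) + \<delta>"
        using q01[OF x] x y Kx dp by (intro dp_integral_le meas_K) auto
      then have "exp (- \<epsilon>) * (\<integral>s. q x s \<partial>K y) \<le> exp (- \<epsilon>) * (exp \<epsilon> * (\<integral>s. q x s \<partial>K x) + \<delta>)"
        by (intro mult_left_mono) auto
      also have "\<dots> = (\<integral>s. q x s \<partial>K x) + exp (- \<epsilon>) * \<delta>"
        by (simp add: distrib_left exp_minus)
      also have "exp (- \<epsilon>) * \<delta> \<le> 1 * \<delta>"
        using \<open>0 \<le> \<epsilon>\<close> \<open>0 \<le> \<delta>\<close> by (intro mult_right_mono) auto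
      finally show ?thesis by simp
    qed
    ultimately have "(\<Sum>l\<in>L. w l x * (\<integral>s. h l s \<partial>K x))
        \<le> k * (exp \<epsilon> * (\<integral>s. p x s \<partial>K y) - exp (- \<epsilon>) * (\<integral>s. q x s \<partial>K y) + 2 * \<delta>)"
      using k by simp
    then show ?thesis
      using int_pq[OF x y] by (simp add: distrib_left)
  qed
  \<comment> \<open>For fixed \<open>s\<close>, \<open>G\<close> sums to zero over \<open>x\<close>,
    so \<open>p\<close> and \<open>q\<close> have equal sums, each half of the L1 norm of
    \<open>G\<close> divided by \<open>k\<close>. What remains of the weights is exp \<epsilon> -
    exp (- \<epsilon>), which is small for small \<epsilon>.\<close>
  have pw: "(\<Sum>x\<in>X. exp \<epsilon> * p x s - exp (- \<epsilon>) * q x s)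
      \<le> (exp \<epsilon> - exp (- \<epsilon>)) * (real (card X) * sqrt k / (2 * k))" if s: "s \<in> space S" for s
  proof -
    have "(\<Sum>x\<in>X. G x s) = (\<Sum>l\<in>L. \<Sum>x\<in>X. w l x * h l s)"
      unfolding G_def by (rule sum.swap)
    also have "\<dots> = 0"
      using mean by (simp flip: sum_distrib_right)
    finally have G0: "(\<Sum>x\<in>X. G x s) = 0" .
    have "(\<Sum>x\<in>X. p x s) - (\<Sum>x\<in>X. q x s) = (\<Sum>x\<in>X. G x s / k)"
      unfolding sum_subtractf[symmetric] using k by (intro sum.cong) (auto simp: G_eq field_simps)
    also have "\<dots> = 0" using G0 by (simp flip: sum_divide_distrib)
    finally have eq: "(\<Sum>x\<in>X. p x s) = (\<Sum>x\<in>X. q x s)" by simp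
    have "(\<Sum>x\<in>X. p x s) + (\<Sum>x\<in>X. q x s) = (\<Sum>x\<in>X. \<bar>G x s\<bar>) / k"
      unfolding sum.distrib[symmetric] sum_divide_distrib
      by (intro sum.cong) (auto simp: p_def q_def max_def)
    also have "\<dots> \<le> real (card X) * sqrt k / k"
      unfolding G_def k_def using assms(1,3) orth h1[OF _ s]
      by (intro divide_right_mono sum_abs_orthogonal_le) auto
    finally have le: "(\<Sum>x\<in>X. p x s) \<le> real (card X) * sqrt k / (2 * k)"
      using eq by (simp add: field_simps)
    have "(\<Sum>x\<in>X. exp \<epsilon> * p x s - exp (- \<epsilon>) * q x s)
        = (exp \<epsilon> - exp (- \<epsilon>)) * (\<Sum>x\<in>X. p x s)"
      by (simp add: sum_subtractf eq left_diff_distrib flip: sum_distrib_left)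
    also have "\<dots> \<le> (exp \<epsilon> - exp (- \<epsilon>)) * (real (card X) * sqrt k / (2 * k))"
      using le \<open>0 \<le> \<epsilon>\<close> by (intro mult_left_mono) auto
    finally show ?thesis .
  qed
  interpret Ky: prob_space "K y" using Kx y by blast
  have "(\<Sum>x\<in>X. \<Sum>l\<in>L. w l x * (\<integral>s. h l s \<partial>K x))
      \<le> (\<Sum>x\<in>X. k * (\<integral>s. exp \<epsilon> * p x s - exp (- \<epsilon>) * q x s \<partial>K y) + k * (2 * \<delta>))"
    by (intro sum_mono step)
  \<comment> \<open>All integrals are now against the same law \<open>K y\<close>, so the sum over
    \<open>x\<close> moves inside and the pointwise bound applies.\<close>
  also have "\<dots> = k * (\<integral>s. (\<Sum>x\<in>X. exp \<epsilon> * p x s - exp (- \<epsilon>) * q x s) \<partial>K y)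
      + real (card X) * (k * (2 * \<delta>))"
    using int_pq y
    by (subst Bochner_Integration.integral_sum) (auto simp: sum.distrib sum_distrib_left)
  also have "(\<integral>s. (\<Sum>x\<in>X. exp \<epsilon> * p x s - exp (- \<epsilon>) * q x s) \<partial>K y)
      \<le> (\<integral>s. (exp \<epsilon> - exp (- \<epsilon>)) * (real (card X) * sqrt k / (2 * k)) \<partial>K y)"
    using int_pq y Kx(3)[OF y] by (intro integral_mono pw) auto
  also have "\<dots> = (exp \<epsilon> - exp (- \<epsilon>)) * (real (card X) * sqrt k / (2 * k))"
    by (simp add: Ky.prob_space)
  finally have "(\<Sum>x\<in>X. \<Sum>l\<in>L. w l x * (\<integral>s. h l s \<partial>K x))
      \<le> k * ((exp \<epsilon> - exp (- \<epsilon>)) * (real (card X) * sqrt k / (2 * k))) + real (card X) * (k * (2 * \<delta>))"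
    using k by simp
  also have "\<dots> = real (card X) * ((exp \<epsilon> - exp (- \<epsilon>)) / 2 * sqrt k + 2 * \<delta> * k)"
    using k by (simp add: field_simps)
  finally show ?thesis unfolding k_def .
qed auto


section \<open>Runs of an online algorithm\<close>

lemma prob_algebraD:
  assumes "N \<in> space (prob_algebra S)"
  shows "prob_space N" "sets N = sets S" "space N = space S"
  using assms sets_eq_imp_space_eq[of N S] by (auto simp: space_prob_algebra)

lemma bind_in_prob_algebra:
  assumes "A \<in> space (prob_algebra M)" "B \<in> M \<rightarrow>\<^sub>M prob_algebra N"
  shows "A \<bind> B \<in> space (prob_algebra N)"
  using prob_space_bind'[OF assms] sets_bind'[OF assms] by (simp add: space_prob_algebra)

lemma measurable_process:
  assumes M: "online_algorithm X S Q M" and "set xs \<subseteq> X" "2 \<le> i"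
  shows "process S M i xs \<in> S \<rightarrow>\<^sub>M prob_algebra S"
  using assms(2,3)
proof (induction xs arbitrary: i)
  case Nil
  then show ?case
    using measurable_return_prob_space by (simp cong: measurable_cong)
next
  case (Cons x xs)
  then have "step_map M i x \<in> S \<rightarrow>\<^sub>M prob_algebra S"
    using M by (simp add: online_algorithm_def)
  moreover have "process S M (Suc i) xs \<in> S \<rightarrow>\<^sub>M prob_algebra S"
    using Cons by simp
  ultimately show ?case
    using measurable_bind_prob_space by (simp cong: measurable_cong)
qed

text \<open>The Chapman-Kolmogorov equation, by associativity of bind; the second block continues
  with the step number that the first one has reached.\<close>

lemma process_append:
  assumes M: "online_algorithm X S Q M" and "set xs \<subseteq> X" "set ys \<subseteq> X" "2 \<le> i" "s \<in> space S"
  shows "process S M i (xs @ ys) s = process S M i xs s \<bind> process S M (i + length xs) ys"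
  using assms(2-)
proof (induction xs arbitrary: i s)
  case Nil
  then show ?case
    using measurable_process[OF M, of ys i]
    by (simp add: bind_return[where N = S] measurable_prob_algebraD)
next
  case (Cons x xs)
  have x: "step_map M i x \<in> S \<rightarrow>\<^sub>M prob_algebra S"
    using M Cons.prems by (simp add: online_algorithm_def)
  have sx: "step_map M i x s \<in> space (prob_algebra S)"
    using measurable_space[OF x] Cons.prems by simp
  then have sets_sx: "sets (step_map M i x s) = sets S" "space (step_map M i x s) = space S"
    by (rule prob_algebraD)+
  have "step_map M i x s \<bind> process S M (Suc i) (xs @ ys)
      = step_map M i x s \<bind> (\<lambda>s. process S M (Suc i) xs s \<bind> process S M (Suc i + length xs) ys)"
    using Cons sets_sx by (intro bind_cong) auto
  also have "\<dots> = step_map M i x s \<bind> process S M (Suc i) xs \<bind> process S M (Suc i + length xs) ys"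
    using measurable_process[OF M, of xs "Suc i"] measurable_process[OF M, of ys "Suc i + length xs"] Cons.prems
      measurable_cong_sets[OF sets_sx(1) refl]
    by (intro bind_assoc[symmetric, of _ _ S _ S]) (auto intro: measurable_prob_algebraD)
  finally show ?case by simp
qed

lemma internal_state_in_prob_algebra:
  assumes M: "online_algorithm X S Q M" and "set xs \<subseteq> X" "xs \<noteq> []"
  shows "internal_state S M xs \<in> space (prob_algebra S)"
proof -
  have "init_map M (hd xs) \<in> space (prob_algebra S)"
    using assms hd_in_set[OF \<open>xs \<noteq> []\<close>] unfolding online_algorithm_def by blast
  moreover have "process S M 2 (tl xs) \<in> S \<rightarrow>\<^sub>M prob_algebra S"
    using assms by (intro measurable_process[OF M]) (auto dest: list.set_sel(2))
  ultimately show ?thesis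
    unfolding internal_state_def by (rule bind_in_prob_algebra)
qed

text \<open>\<open>init_map\<close> consumes element 1 and \<open>process\<close> starts at element
  2, so the element after \<open>xs\<close> has number \<open>Suc (length xs)\<close>.\<close>

lemma internal_state_append:
  assumes M: "online_algorithm X S Q M" and "set xs \<subseteq> X" "set ys \<subseteq> X" "xs \<noteq> []"
  shows "internal_state S M (xs @ ys) = internal_state S M xs \<bind> process S M (Suc (length xs)) ys"
proof -
  obtain x zs where xs: "xs = x # zs" using \<open>xs \<noteq> []\<close> by (cases xs) auto
  have x: "init_map M x \<in> space (prob_algebra S)"
    using assms xs by (auto simp: online_algorithm_def)
  then have sets_x: "sets (init_map M x) = sets S" "space (init_map M x) = space S"
    by (rule prob_algebraD)+
  have "init_map M x \<bind> process S M 2 (zs @ ys)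
      = init_map M x \<bind> (\<lambda>s. process S M 2 zs s \<bind> process S M (2 + length zs) ys)"
    using assms sets_x xs by (intro bind_cong process_append[OF M]) auto
  also have "\<dots> = init_map M x \<bind> process S M 2 zs \<bind> process S M (2 + length zs) ys"
    using measurable_process[OF M, of zs 2] measurable_process[OF M, of ys "2 + length zs"] assms xs
      measurable_cong_sets[OF sets_x(1) refl]
    by (intro bind_assoc[symmetric, of _ _ S _ S]) (auto intro: measurable_prob_algebraD)
  finally show ?thesis by (simp add: internal_state_def xs)
qed

section \<open>The output as post-processing of a state, and privacy of the state\<close>

definition output_from ::
  "'s measure \<Rightarrow> ('x, 's, 'o) online_alg \<Rightarrow> nat \<Rightarrow> 'x list \<Rightarrow> 's \<Rightarrow> 'o measure" where
  "output_from S M i xs s = process S M i xs s \<bind> out_map M"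

lemma measurable_output_from:
  assumes M: "online_algorithm X S Q M" and "set xs \<subseteq> X" "2 \<le> i"
  shows "output_from S M i xs \<in> S \<rightarrow>\<^sub>M prob_algebra Q"
  unfolding output_from_def using M
  by (intro measurable_bind_prob_space[OF measurable_process[OF assms]])
     (auto simp: online_algorithm_def)

lemma alg_output_in_prob_algebra:
  assumes M: "online_algorithm X S Q M" and "set xs \<subseteq> X" "xs \<noteq> []"
  shows "alg_output S M xs \<in> space (prob_algebra Q)"
proof -
  have "out_map M \<in> S \<rightarrow>\<^sub>M prob_algebra Q"
    using M by (simp add: online_algorithm_def)
  then show ?thesis
    using internal_state_in_prob_algebra[OF assms]
    unfolding alg_output_def by (intro bind_in_prob_algebra)
qed

text \<open>Given the state after \<open>xs\<close>, the rest of the run is a kernel. The output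
  probability thus becomes the integral of a [0, 1]-valued function of the state, the form in which
  privacy of the state can be applied.\<close>

lemma measure_alg_output_append:
  assumes M: "online_algorithm X S Q M" and "set xs \<subseteq> X" "set ys \<subseteq> X" "xs \<noteq> []" and A: "A \<in> sets Q"
  shows "measure (alg_output S M (xs @ ys)) A
    = (\<integral>s. measure (output_from S M (Suc (length xs)) ys s) A \<partial>internal_state S M xs)"
proof -
  have I: "internal_state S M xs \<in> space (prob_algebra S)"
    using assms by (intro internal_state_in_prob_algebra[OF M])
  then interpret prob_space "internal_state S M xs"
    by (simp add: space_prob_algebra)
  have sets_I: "sets (internal_state S M xs) = sets S"
    using I by (simp add: space_prob_algebra)
  note cong = measurable_cong_sets[OF sets_I refl]
  have i: "2 \<le> Suc (length xs)" using \<open>xs \<noteq> []\<close> by (cases xs) auto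
  have "alg_output S M (xs @ ys)
      = internal_state S M xs \<bind> process S M (Suc (length xs)) ys \<bind> out_map M"
    using assms by (simp add: alg_output_def internal_state_append[OF M])
  also have "\<dots> = internal_state S M xs \<bind> output_from S M (Suc (length xs)) ys"
    unfolding output_from_def
    using measurable_process[OF M \<open>set ys \<subseteq> X\<close> i] M cong
    by (intro bind_assoc[of _ _ S _ Q]) (auto intro: measurable_prob_algebraD simp: online_algorithm_def)
  finally show ?thesis
    using measurable_prob_algebraD[OF measurable_output_from[OF M \<open>set ys \<subseteq> X\<close> i]] A
    by (simp only: measure_bind cong)
qed

text \<open>The rest of the run has total mass 1, so leaving the output free gives back the law of
  the state. This extracts from pan-privacy a statement about the state alone.\<close>

lemma state_marginal:
  assumes M: "online_algorithm X S Q M" and "set xs \<subseteq> X" and t: "t \<in> {1..length xs}" and T: "T \<in> sets S"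
  shows "measure (state_and_output S Q M xs t) (T \<times> space Q) = measure (internal_state S M (take t xs)) T"
proof -
  define F where "F s = process S M (Suc t) (drop t xs) s \<bind> (\<lambda>s'.
     out_map M s' \<bind> (\<lambda>y. return (S \<Otimes>\<^sub>M Q) (s, y)))" for s
  have I: "internal_state S M (take t xs) \<in> space (prob_algebra S)"
    using assms set_take_subset[of t xs] by (intro internal_state_in_prob_algebra[OF M]) auto
  then interpret prob_space "internal_state S M (take t xs)"
    by (simp add: space_prob_algebra)
  have sets_I: "sets (internal_state S M (take t xs)) = sets S"
    using I by (simp add: space_prob_algebra)
  have P [measurable]: "process S M (Suc t) (drop t xs) \<in> S \<rightarrow>\<^sub>M prob_algebra S"
    using assms set_drop_subset[of t xs] by (intro measurable_process[OF M]) auto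
  have O [measurable]: "out_map M \<in> S \<rightarrow>\<^sub>M prob_algebra Q"
    using M by (simp add: online_algorithm_def)
  have F [measurable]: "F \<in> S \<rightarrow>\<^sub>M prob_algebra (S \<Otimes>\<^sub>M Q)"
    unfolding F_def by measurable
  \<comment> \<open>The pair carries \<open>s\<close> along unchanged, so the event is decided by
    \<open>s\<close> and both inner integrals average a constant.\<close>
  have F_eq: "emeasure (F s) (T \<times> space Q) = indicator T s" if s: "s \<in> space S" for s
  proof -
    note [measurable] = s
    have TQ: "T \<times> space Q \<in> sets (S \<Otimes>\<^sub>M Q)" using T by simp
    have P': "process S M (Suc t) (drop t xs) s \<in> space (prob_algebra S)"
      using measurable_space[OF P s] .
    have K: "(\<lambda>s'. out_map M s' \<bind> (\<lambda>y. return (S \<Otimes>\<^sub>M Q) (s, y))) \<in> S \<rightarrow>\<^sub>M prob_algebra (S \<Otimes>\<^sub>M Q)"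
      by measurable
    have R: "(\<lambda>y. return (S \<Otimes>\<^sub>M Q) (s, y)) \<in> Q \<rightarrow>\<^sub>M prob_algebra (S \<Otimes>\<^sub>M Q)"
      by measurable
    have inner: "emeasure (out_map M s' \<bind> (\<lambda>y. return (S \<Otimes>\<^sub>M Q) (s, y))) (T \<times> space Q) = indicator T s"
      if s': "s' \<in> space S" for s'
    proof -
      have O': "out_map M s' \<in> space (prob_algebra Q)"
        using measurable_space[OF O s'] .
      then interpret O: prob_space "out_map M s'" by (simp add: space_prob_algebra)
      have sp: "space (out_map M s') = space Q"
        using O' by (rule prob_algebraD)
      have "emeasure (out_map M s' \<bind> (\<lambda>y. return (S \<Otimes>\<^sub>M Q) (s, y))) (T \<times> space Q)
          = (\<integral>\<^sup>+y. indicator T s \<partial>out_map M s')"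
        unfolding emeasure_bind_prob_algebra[OF O' R TQ]
        using s TQ sp by (intro nn_integral_cong) (auto simp: indicator_def space_pair_measure)
      then show ?thesis by (simp add: O.emeasure_space_1)
    qed
    interpret P: prob_space "process S M (Suc t) (drop t xs) s"
      using P' by (simp add: space_prob_algebra)
    have sp: "space (process S M (Suc t) (drop t xs) s) = space S"
      using P' by (rule prob_algebraD)
    have "emeasure (F s) (T \<times> space Q) = (\<integral>\<^sup>+s'. indicator T s \<partial>process S M (Suc t) (drop t xs) s)"
      unfolding F_def emeasure_bind_prob_algebra[OF P' K TQ]
      using sp inner by (intro nn_integral_cong) auto
    then show ?thesis by (simp add: P.emeasure_space_1)
  qed
  have sp: "space (internal_state S M (take t xs)) = space S"
    using sets_I by (rule sets_eq_imp_space_eq)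
  have "emeasure (state_and_output S Q M xs t) (T \<times> space Q)
      = emeasure (internal_state S M (take t xs) \<bind> F) (T \<times> space Q)"
    unfolding state_and_output_def F_def ..
  also have "\<dots> = (\<integral>\<^sup>+s. emeasure (F s) (T \<times> space Q) \<partial>internal_state S M (take t xs))"
    using T by (intro emeasure_bind_prob_algebra[OF I F]) auto
  also have "\<dots> = (\<integral>\<^sup>+s. indicator T s \<partial>internal_state S M (take t xs))"
    using sp F_eq by (intro nn_integral_cong) auto
  also have "\<dots> = emeasure (internal_state S M (take t xs)) T"
    using T sets_I by simp
  finally show ?thesis by (simp add: measure_def)
qed

text \<open>Pan-privacy speaks of streams of length \<open>n\<close>, so both prefixes are padded
  with the same elements. The padded streams are neighbors, and the state is observed right after
  the element in which they may differ.\<close>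

lemma pan_private_internal_state:
  assumes M: "online_algorithm X S Q M" and pp: "pan_private X S Q n \<epsilon> \<delta> M"
    and xs: "set xs \<subseteq> X" "length xs < n" and "x \<in> X" "y \<in> X" and T: "T \<in> sets S"
  shows "measure (internal_state S M (xs @ [x])) T
    \<le> exp \<epsilon> * measure (internal_state S M (xs @ [y])) T + \<delta>"
proof -
  define zs where "zs z = (xs @ [z]) @ replicate (n - Suc (length xs)) x" for z
  define t where "t = Suc (length xs)"
  have set_zs: "set (zs z) \<subseteq> X" if "z \<in> X" for z
    using that assms by (auto simp: zs_def)
  have len: "length (zs z) = n" for z
    using xs by (simp add: zs_def)
  have take: "take t (zs z) = xs @ [z]" for z
    by (simp add: zs_def t_def)
  have t: "t \<in> {1..n}" using xs by (simp add: t_def)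
  have "{i. i < n \<and> zs x ! i \<noteq> zs y ! i} \<subseteq> {length xs}"
  proof -
    have eq: "zs x = (zs y)[length xs := x]"
      by (simp add: zs_def list_update_append)
    have "i = length xs" if "zs x ! i \<noteq> zs y ! i" for i
      using that unfolding eq by (cases "i = length xs") simp_all
    then show ?thesis by blast
  qed
  then have "card {i. i < n \<and> zs x ! i \<noteq> zs y ! i} \<le> card {length xs}"
    by (rule card_mono[rotated]) simp
  then have "neighbors (zs x) (zs y)"
    by (simp add: neighbors_def len)
  then have "measure (state_and_output S Q M (zs x) t) (T \<times> space Q)
      \<le> exp \<epsilon> * measure (state_and_output S Q M (zs y) t) (T \<times> space Q) + \<delta>"
    using pp t T set_zs[OF \<open>x \<in> X\<close>] set_zs[OF \<open>y \<in> X\<close>] len unfolding pan_private_def by auto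
  then show ?thesis
    using state_marginal[OF M set_zs[OF \<open>x \<in> X\<close>], of t T] state_marginal[OF M set_zs[OF \<open>y \<in> X\<close>], of t T] t T
    by (simp add: len take)
qed


section \<open>Distributions biased towards a parity\<close>

definition parity_char :: "nat set \<Rightarrow> (nat \<Rightarrow> int) \<Rightarrow> real" where
  "parity_char A x = (\<Prod>j\<in>A. real_of_int (x j))"

lemma finite_data_domain: "finite (data_domain d)"
  by (simp add: data_domain_def finite_PiE)

lemma card_data_domain: "card (data_domain d) = 2 ^ (d + 1)"
  by (simp add: data_domain_def card_PiE numeral_2_eq_2)

lemma data_domain_nonempty: "data_domain d \<noteq> {}"
  using card_data_domain[of d] by auto

text \<open>A sum of products over the cube factorizes into coordinates. A coordinate in both or
  neither of \<open>A\<close> and \<open>B\<close> contributes 2, and a coordinate in exactly one of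
  them contributes 1 + (-1) = 0.\<close>

lemma parity_char_orthogonal:
  assumes "A \<subseteq> {1..d+1}" "B \<subseteq> {1..d+1}"
  shows "(\<Sum>x\<in>data_domain d. parity_char A x * parity_char B x)
    = (if A = B then real (card (data_domain d)) else 0)"
proof -
  define I where "I = {1..d+1}"
  define u :: "nat \<Rightarrow> int \<Rightarrow> real" where
    "u i y = (if i \<in> A then real_of_int y else 1) * (if i \<in> B then real_of_int y else 1)" for i y
  have fI: "finite I" by (simp add: I_def)
  have AB: "A \<subseteq> I" "B \<subseteq> I" using assms by (auto simp: I_def)
  \<comment> \<open>Factors 1 extend the product to all coordinates, so that sum and product can be
    exchanged.\<close>
  have restr: "parity_char C x = (\<Prod>i\<in>I. if i \<in> C then real_of_int (x i) else 1)" if "C \<subseteq> I" for C x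
    using that unfolding parity_char_def by (simp add: fI prod.If_cases Int_absorb1)
  have "(\<Sum>x\<in>data_domain d. parity_char A x * parity_char B x)
      = (\<Sum>x\<in>PiE I (\<lambda>_. {-1, 1}). \<Prod>i\<in>I. u i (x i))"
    unfolding data_domain_def I_def[symmetric]
    by (simp add: restr[OF AB(1)] restr[OF AB(2)] u_def prod.distrib)
  also have "\<dots> = (\<Prod>i\<in>I. \<Sum>y\<in>{-1, 1}. u i y)"
    by (rule prod_sum_PiE[symmetric]) (auto simp: I_def)
  also have "\<dots> = (\<Prod>i\<in>I. if i \<in> A \<longleftrightarrow> i \<in> B then 2 else 0)"
    by (intro prod.cong) (auto simp: u_def)
  also have "\<dots> = (if A = B then 2 ^ (d + 1) else 0)"
  proof (cases "A = B")
    case False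
    then obtain i where "i \<in> I" "(i \<in> A) \<noteq> (i \<in> B)" using AB by blast
    then show ?thesis using False fI by (auto intro!: prod_zero)
  qed (simp add: I_def)
  finally show ?thesis by (simp add: card_data_domain)
qed

lemma sum_parity_char:
  assumes "A \<subseteq> {1..d+1}" "A \<noteq> {}"
  shows "(\<Sum>x\<in>data_domain d. parity_char A x) = 0"
  using parity_char_orthogonal[OF assms(1), of "{}"] assms(2) by (simp add: parity_char_def)

text \<open>Adding the label is injective on subsets of \<open>{1..d}\<close>. On the data domain,
  the character of \<open>insert (d+1) l\<close> is 1 where the parity of \<open>l\<close> equals
  the label and -1 where it does not.\<close>

lemma labelled_parity_char_orthogonal:
  assumes "l \<subseteq> {1..d}" "l' \<subseteq> {1..d}"
  shows "(\<Sum>x\<in>data_domain d. parity_char (insert (d+1) l) x * parity_char (insert (d+1) l') x)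
    = (if l = l' then real (card (data_domain d)) else 0)"
proof -
  have "insert (d+1) l = insert (d+1) l' \<longleftrightarrow> l = l'"
    using assms by (intro insert_ident) auto
  moreover have "insert (d+1) l \<subseteq> {1..d+1}" "insert (d+1) l' \<subseteq> {1..d+1}"
    using assms by auto
  ultimately show ?thesis by (simp only: parity_char_orthogonal)
qed

lemma data_domain_coord: "x \<in> data_domain d \<Longrightarrow> j \<in> {1..d+1} \<Longrightarrow> x j = 1 \<or> x j = -1"
  unfolding data_domain_def by (drule (1) PiE_mem) auto

lemma prod_signs:
  fixes x :: "'a \<Rightarrow> int"
  assumes "\<And>j. j \<in> A \<Longrightarrow> x j = 1 \<or> x j = -1"
  shows "prod x A = 1 \<or> prod x A = -1"
  using assms
proof (induction A rule: infinite_finite_induct)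
  case (insert a F)
  have "x a = 1 \<or> x a = -1" using insert.prems by blast
  moreover have "prod x F = 1 \<or> prod x F = -1" using insert by blast
  ultimately show ?case using insert.hyps by auto
qed auto

lemma parity_char_cases:
  assumes "x \<in> data_domain d" "A \<subseteq> {1..d+1}"
  shows "parity_char A x = 1 \<or> parity_char A x = -1"
proof -
  have "prod x A = 1 \<or> prod x A = -1"
    using assms data_domain_coord by (intro prod_signs) blast
  then show ?thesis by (auto simp: parity_char_def simp flip: of_int_prod)
qed

section \<open>Biased distributions and the errors of parities under them\<close>

definition biased_pmf :: "nat \<Rightarrow> nat set \<Rightarrow> real \<Rightarrow> (nat \<Rightarrow> int) pmf" where
  "biased_pmf d A a = embed_pmf (\<lambda>x. if x \<in> data_domain d
     then (1 + 2 * a * parity_char A x) / real (card (data_domain d)) else 0)"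

text \<open>The weights are nonnegative because the character has values 1 and -1 and \<bar>a\<bar>
  \<le> 1/2; they sum to 1 because the character of a nonempty set sums to zero. Under this law the
  character has mean 2 a.\<close>

lemma pmf_biased_pmf:
  assumes A: "A \<subseteq> {1..d+1}" "A \<noteq> {}" and a: "\<bar>a\<bar> \<le> 1/2"
  shows "pmf (biased_pmf d A a) x = (if x \<in> data_domain d
     then (1 + 2 * a * parity_char A x) / real (card (data_domain d)) else 0)"
  unfolding biased_pmf_def
proof (rule pmf_embed_pmf)
  let ?f = "\<lambda>x. if x \<in> data_domain d
     then (1 + 2 * a * parity_char A x) / real (card (data_domain d)) else 0"
  show nonneg: "0 \<le> ?f x" for x
    using parity_char_cases[OF _ A(1), of x] a by auto
  have "(\<integral>\<^sup>+x. ennreal (?f x) \<partial>count_space UNIV) = (\<Sum>x\<in>data_domain d. ennreal (?f x))"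
    by (intro nn_integral_count_space') (auto simp: finite_data_domain)
  also have "\<dots> = ennreal (\<Sum>x\<in>data_domain d. ?f x)"
    using nonneg by (intro sum_ennreal)
  also have "(\<Sum>x\<in>data_domain d. ?f x) = (\<Sum>x\<in>data_domain d. 1 + 2 * a * parity_char A x) / real (card (data_domain d))"
    by (simp add: sum_divide_distrib)
  also have "\<dots> = 1"
    by (simp add: sum.distrib sum_parity_char[OF A] card_data_domain flip: sum_distrib_left)
  finally show "(\<integral>\<^sup>+x. ennreal (?f x) \<partial>count_space UNIV) = 1" by simp
qed

lemma set_biased_pmf:
  assumes "A \<subseteq> {1..d+1}" "A \<noteq> {}" "\<bar>a\<bar> \<le> 1/2"
  shows "set_pmf (biased_pmf d A a) \<subseteq> data_domain d"
  using pmf_biased_pmf[OF assms] by (auto simp: set_pmf_iff split: if_splits)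

text \<open>An error probability is 1/2 minus half the mean of \<open>b'\<close> times the labelled
  character of \<open>l'\<close>. By orthogonality this mean vanishes unless \<open>l' = l\<close>,
  so the bias is invisible to every other set. The factor 2 in the density makes the advantage
  exactly \<alpha>.\<close>

lemma parity_err_biased_pmf:
  assumes l: "l \<subseteq> {1..d}" "l' \<subseteq> {1..d}" and b: "b \<in> {-1, 1}" "b' \<in> {-1, 1}"
    and \<alpha>: "\<bar>\<alpha>\<bar> \<le> 1/2"
  shows "parity_err d (biased_pmf d (insert (d+1) l) (real_of_int b * \<alpha>)) (l', b')
    = 1/2 - (if l = l' then real_of_int (b * b') * \<alpha> else 0)"
proof -
  define X where "X = data_domain d"
  define w where "w l x = parity_char (insert (d+1) l) x" for l x
  define P where "P = biased_pmf d (insert (d+1) l) (real_of_int b * \<alpha>)"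
  have sub: "insert (d+1) l \<subseteq> {1..d+1}" "insert (d+1) l' \<subseteq> {1..d+1}"
    using l by auto
  have a: "\<bar>real_of_int b * \<alpha>\<bar> \<le> 1/2" using \<alpha> b by (auto simp: abs_mult)
  have P: "pmf P x = (1 + 2 * (real_of_int b * \<alpha>) * w l x) / real (card X)" if "x \<in> X" for x
    using that sub a by (simp add: P_def w_def X_def pmf_biased_pmf)
  have setP: "set_pmf P \<subseteq> X"
    unfolding P_def X_def using sub a by (intro set_biased_pmf) auto
  have card: "real (card X) > 0" by (simp add: X_def card_data_domain)
  let ?E = "{x. b' * (\<Prod>j\<in>l'. x j) \<noteq> x (d+1)}"
  \<comment> \<open>\<open>b'\<close>, the parity and the label are signs, so their product is 1 if
    the prediction is right and -1 if it is wrong.\<close>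
  have ind: "indicator ?E x = (1 - real_of_int b' * w l' x) / 2" if x: "x \<in> X" for x
  proof -
    have "x (d+1) = 1 \<or> x (d+1) = -1"
      using x data_domain_coord[of x d "d+1"] by (simp add: X_def)
    moreover have "prod x l' = 1 \<or> prod x l' = -1"
      using x l by (intro prod_signs data_domain_coord[of x d]) (auto simp: X_def)
    moreover have "w l' x = real_of_int (x (d+1)) * real_of_int (prod x l')"
      using l finite_subset[OF l(2)] by (subst w_def, subst parity_char_def, subst prod.insert) auto
    ultimately show ?thesis using b
      by (elim disjE insertE emptyE) (simp_all add: indicator_def del: of_int_prod)
  qed
  have "parity_err d P (l', b') = (\<integral>x. indicator ?E x \<partial>measure_pmf P)"
    by (simp add: parity_err_def)
  also have "\<dots> = (\<Sum>x\<in>X. indicator ?E x * pmf P x)"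
    using setP by (intro integral_measure_pmf_real) (auto simp: X_def finite_data_domain)
  also have "\<dots> = (\<Sum>x\<in>X. (1 - real_of_int b' * w l' x) / 2
      * ((1 + 2 * (real_of_int b * \<alpha>) * w l x) / real (card X)))"
    by (intro sum.cong refl arg_cong2[where f = "(*)"] ind P)
  also have "\<dots> = (\<Sum>x\<in>X. (1 + 2 * (real_of_int b * \<alpha>) * w l x - real_of_int b' * w l' x
      - 2 * (real_of_int b * real_of_int b' * \<alpha>) * (w l x * w l' x)) / (2 * real (card X)))"
    unfolding times_divide_times_eq
    by (intro sum.cong refl arg_cong2[where f = "(/)"]) (simp add: algebra_simps)
  \<comment> \<open>Both sums of a single character vanish; the constant and the product of the two
    characters remain.\<close>
  also have "\<dots> = (real (card X) - 2 * (real_of_int b * real_of_int b' * \<alpha>) * (\<Sum>x\<in>X. w l x * w l' x))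
      / (2 * real (card X))"
    unfolding w_def X_def using sum_parity_char[OF sub(1)] sum_parity_char[OF sub(2)]
    by (simp add: sum_subtractf sum.distrib flip: sum_divide_distrib sum_distrib_left)
  also have "(\<Sum>x\<in>X. w l x * w l' x) = (if l = l' then real (card X) else 0)"
    unfolding w_def X_def using l by (rule labelled_parity_char_orthogonal)
  also have "(real (card X) - 2 * (real_of_int b * real_of_int b' * \<alpha>) * (if l = l' then real (card X) else 0))
      / (2 * real (card X)) = 1/2 - (if l = l' then real_of_int (b * b') * \<alpha> else 0)"
    using card by (cases "l = l'") (simp_all add: field_simps)
  finally show ?thesis unfolding P_def .
qed

lemma opt_err_biased_pmf_le:
  assumes "l \<subseteq> {1..d}" "card l \<le> k" "b \<in> {-1, 1}" "\<bar>\<alpha>\<bar> \<le> 1/2"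
  shows "opt_err d k (biased_pmf d (insert (d+1) l) (real_of_int b * \<alpha>)) \<le> 1/2 - \<alpha>"
proof -
  let ?P = "biased_pmf d (insert (d+1) l) (real_of_int b * \<alpha>)"
  let ?H = "{(l, b) \<in> signed_parities d. card l \<le> k}"
  have "finite ?H"
    by (rule finite_subset[of _ "signed_parities d"]) (auto simp: signed_parities_def)
  moreover have "(l, b) \<in> ?H"
    using assms by (auto simp: signed_parities_def)
  ultimately have "opt_err d k ?P \<le> parity_err d ?P (l, b)"
    unfolding opt_err_def by (intro Min_le) auto
  also have "\<dots> = 1/2 - \<alpha>"
    using assms parity_err_biased_pmf[of l d l b b \<alpha>] by auto
  finally show ?thesis .
qed

text \<open>The optimum is at most 1/2 - \<alpha>, so a good hypothesis has error strictly below
  1/2. Other sets have error exactly 1/2, and \<open>l\<close> with the wrong sign has 1/2 +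
  \<alpha>. Learning is therefore identification of \<open>(l, b)\<close>.\<close>

lemma near_optimal_biased_pmf:
  assumes "l \<subseteq> {1..d}" "card l \<le> k" "b \<in> {-1, 1}" "0 < \<alpha>" "\<alpha> \<le> 1/2"
  shows "{h \<in> signed_parities d. parity_err d (biased_pmf d (insert (d+1) l) (real_of_int b * \<alpha>)) h
      < opt_err d k (biased_pmf d (insert (d+1) l) (real_of_int b * \<alpha>)) + \<alpha>} \<subseteq> {(l, b)}"
proof clarify
  fix l' b'
  let ?P = "biased_pmf d (insert (d+1) l) (real_of_int b * \<alpha>)"
  assume h: "(l', b') \<in> signed_parities d" and err: "parity_err d ?P (l', b') < opt_err d k ?P + \<alpha>"
  have "parity_err d ?P (l', b') < 1/2"
    using err opt_err_biased_pmf_le[of l d k b \<alpha>] assms by auto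
  then have "(if l = l' then real_of_int (b * b') * \<alpha> else 0) > 0"
    using parity_err_biased_pmf[of l d l' b b' \<alpha>] h assms by (auto simp: signed_parities_def)
  then show "l' = l \<and> b' = b"
    using assms h by (auto simp: signed_parities_def split: if_splits)
qed

text \<open>The subsets are sorted by cardinality; the empty set is left out because the sum in
  \<open>binom_le\<close> starts at 1.\<close>

lemma card_subsets_binom_le: "card {l. l \<subseteq> {1..d} \<and> 1 \<le> card l \<and> card l \<le> k} = binom_le d k"
proof -
  have "{l. l \<subseteq> {1..d} \<and> 1 \<le> card l \<and> card l \<le> k} = (\<Union>j\<in>{1..k}. {l. l \<subseteq> {1..d} \<and> card l = j})"
    by auto
  also have "card \<dots> = (\<Sum>j\<in>{1..k}. card {l. l \<subseteq> {1..d} \<and> card l = j})"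
    by (intro card_UN_disjoint) auto
  also have "\<dots> = binom_le d k"
    unfolding binom_le_def using n_subsets[of "{1..d}"] by simp
  finally show ?thesis .
qed

section \<open>Independent samples and hybrid streams\<close>

lemma finite_set_replicate_pmf:
  "finite (set_pmf p) \<Longrightarrow> finite (set_pmf (replicate_pmf m p))"
  unfolding set_replicate_pmf using finite_lists_length_eq[of "set_pmf p" m]
  by (auto simp: lists_eq_set conj_commute)

lemma expectation_replicate_pmf_Suc:
  fixes f :: "'a list \<Rightarrow> real"
  assumes "finite X" "set_pmf p \<subseteq> X"
  shows "measure_pmf.expectation (replicate_pmf (Suc m) p) f
    = (\<Sum>x\<in>X. pmf p x * measure_pmf.expectation (replicate_pmf m p) (\<lambda>xs. f (x # xs)))"
proof -
  have fin: "finite (set_pmf (replicate_pmf m p))"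
    using assms by (intro finite_set_replicate_pmf) (rule finite_subset[rotated])
  have eq: "replicate_pmf (Suc m) p = p \<bind> (\<lambda>x. map_pmf (Cons x) (replicate_pmf m p))"
    by (simp add: map_pmf_def)
  show ?thesis
    unfolding eq using assms fin by (subst pmf_expectation_bind[of X]) auto
qed

text \<open>Splitting is needed at both ends: the element exchanged between consecutive hybrids is
  the last one of the block from \<open>U\<close> in one of them and the first one of the block from
  \<open>p\<close> in the other.\<close>

lemma expectation_replicate_pmf_snoc:
  fixes f :: "'a list \<Rightarrow> real"
  assumes "finite X" "set_pmf p \<subseteq> X"
  shows "measure_pmf.expectation (replicate_pmf (Suc m) p) f
    = measure_pmf.expectation (replicate_pmf m p) (\<lambda>xs. \<Sum>x\<in>X. pmf p x * f (xs @ [x]))"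
proof -
  let ?R = "replicate_pmf m p"
  have fin: "finite (set_pmf ?R)" "finite (set_pmf p)"
    using assms finite_subset by (auto intro: finite_set_replicate_pmf)
  have "replicate_pmf (Suc m) p = replicate_pmf (m + 1) p" by simp
  also have "\<dots> = ?R \<bind> (\<lambda>xs. map_pmf (\<lambda>x. xs @ [x]) p)"
    by (subst replicate_pmf_distrib, subst replicate_pmf_1) (simp add: map_pmf_def bind_assoc_pmf bind_return_pmf)
  finally have "measure_pmf.expectation (replicate_pmf (Suc m) p) f
      = (\<Sum>xs\<in>set_pmf ?R. pmf ?R xs * measure_pmf.expectation p (\<lambda>x. f (xs @ [x])))"
    using fin by (simp add: pmf_expectation_bind[of "set_pmf ?R"])
  also have "\<dots> = measure_pmf.expectation ?R (\<lambda>xs. measure_pmf.expectation p (\<lambda>x. f (xs @ [x])))"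
    using fin by (simp add: integral_measure_pmf[of "set_pmf ?R"])
  also have "(\<lambda>xs. measure_pmf.expectation p (\<lambda>x. f (xs @ [x]))) = (\<lambda>xs. \<Sum>x\<in>X. pmf p x * f (xs @ [x]))"
    using assms by (subst integral_measure_pmf[of X]) auto
  finally show ?thesis .
qed

text \<open>The interpolation of a hybrid argument, from a sample of \<open>p\<close> at
  \<open>t = 0\<close> to a sample of \<open>U\<close> at \<open>t = n\<close>.\<close>

definition hybrid :: "'a pmf \<Rightarrow> 'a pmf \<Rightarrow> nat \<Rightarrow> ('a list \<Rightarrow> real) \<Rightarrow> nat \<Rightarrow> real" where
  "hybrid U p n F t = measure_pmf.expectation (replicate_pmf t U) (\<lambda>ys.
     measure_pmf.expectation (replicate_pmf (n - t) p) (\<lambda>zs. F (ys @ zs)))"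

text \<open>Prefix \<open>ys\<close> and suffix \<open>zs\<close> have the same laws in both
  hybrids, so only the law of element number \<open>t + 1\<close> changes, from \<open>p\<close> to
  \<open>U\<close>.\<close>

lemma hybrid_diff:
  assumes "finite X" "set_pmf p \<subseteq> X" "set_pmf U \<subseteq> X" "t < n"
  shows "hybrid U p n F t - hybrid U p n F (Suc t) = measure_pmf.expectation (replicate_pmf t U)
    (\<lambda>ys. \<Sum>x\<in>X. (pmf p x - pmf U x) *
      measure_pmf.expectation (replicate_pmf (n - Suc t) p) (\<lambda>zs. F ((ys @ [x]) @ zs)))"
proof -
  let ?E = "\<lambda>ys x. measure_pmf.expectation (replicate_pmf (n - Suc t) p) (\<lambda>zs. F ((ys @ [x]) @ zs))"
  have int: "integrable (measure_pmf (replicate_pmf t U)) f" for f :: "'a list \<Rightarrow> real"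
    using assms(1,3)
    by (intro integrable_measure_pmf_finite finite_set_replicate_pmf) (rule finite_subset)
  have "n - t = Suc (n - Suc t)" using \<open>t < n\<close> by simp
  then have "hybrid U p n F t = measure_pmf.expectation (replicate_pmf t U) (\<lambda>ys. \<Sum>x\<in>X. pmf p x * ?E ys x)"
    unfolding hybrid_def using assms
    by (simp only: expectation_replicate_pmf_Suc[of X] append_assoc append_Cons append_Nil)
  moreover have "hybrid U p n F (Suc t) =
      measure_pmf.expectation (replicate_pmf t U) (\<lambda>ys. \<Sum>x\<in>X. pmf U x * ?E ys x)"
    unfolding hybrid_def using assms by (intro expectation_replicate_pmf_snoc)
  ultimately show ?thesis
    by (simp only: Bochner_Integration.integral_diff[OF int int, symmetric] left_diff_distrib sum_subtractf)
qed

lemma hybrid_0: "hybrid U p n F 0 = measure_pmf.expectation (replicate_pmf n p) F"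
  by (simp add: hybrid_def)

lemma hybrid_self: "hybrid U p n F n = measure_pmf.expectation (replicate_pmf n U) F"
  by (simp add: hybrid_def)


section \<open>The lower bound\<close>

text \<open>The uniform prefix has the same law for all \<open>(l, b)\<close> and can be fixed. The
  state after one more element is then a private local randomizer of that element, and
  \<open>local_randomizer_correlation_le\<close> treats all of \<open>L\<close> at once.\<close>

lemma hybrid_step_le:
  fixes M :: "(nat \<Rightarrow> int, 's, nat set \<times> int) online_alg"
  assumes M: "online_algorithm (data_domain d) S (count_space (signed_parities d)) M"
    and pp: "pan_private (data_domain d) S (count_space (signed_parities d)) n \<epsilon> \<delta> M"
    and L: "L \<subseteq> Pow {1..d}" and "t < n" "0 \<le> \<epsilon>" "0 \<le> \<delta>" "0 \<le> \<alpha>" "\<alpha> \<le> 1/2"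
  defines "U \<equiv> pmf_of_set (data_domain d)"
    and "P \<equiv> \<lambda>l b. biased_pmf d (insert (d+1) l) (real_of_int b * \<alpha>)"
    and "F \<equiv> \<lambda>l b xs. measure (alg_output S M xs) {(l, b)}"
  shows "(\<Sum>l\<in>L. \<Sum>b\<in>{-1,1}. hybrid U (P l b) n (F l b) t - hybrid U (P l b) n (F l b) (Suc t))
    \<le> 2 * \<alpha> * ((exp \<epsilon> - exp (- \<epsilon>)) / 2 * sqrt (real (card L)) + 2 * \<delta> * real (card L))"
    (is "_ \<le> ?bound")
proof -
  define X where "X = data_domain d"
  define Q where "Q = count_space (signed_parities d)"
  define m where "m = n - Suc t"
  define w where "w l x = parity_char (insert (d+1) l) x" for l x
  define N where "N = real (card X)"
  \<comment> \<open>The chance of finally emitting \<open>(l, b)\<close> from state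
    \<open>s\<close>, averaged over the remaining samples. After \<open>t + 1\<close> elements the
    next one has number \<open>Suc (Suc t)\<close>.\<close>
  define g where "g l b s = measure_pmf.expectation (replicate_pmf m (P l b))
    (\<lambda>zs. measure (output_from S M (Suc (Suc t)) zs s) {(l, b)})" for l b s
  have finX: "finite X" and X_ne: "X \<noteq> {}"
    by (simp_all add: X_def finite_data_domain data_domain_nonempty)
  then have N: "0 < N" by (simp add: N_def card_gt_0_iff)
  have finL: "finite L" using L by (rule finite_subset) simp
  have M': "online_algorithm X S Q M" and pp': "pan_private X S Q n \<epsilon> \<delta> M"
    using M pp by (simp_all add: X_def Q_def)
  have sub: "insert (d+1) l \<subseteq> {1..d+1}" if "l \<in> L" for l
  proof -
    have "l \<subseteq> {1..d}" using that L by blast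
    then show ?thesis by auto
  qed
  have h_sets: "{(l, b)} \<in> sets Q" if "l \<in> L" "b \<in> {-1, 1}" for l b
    using that L by (auto simp: Q_def signed_parities_def)
  have P_sub: "set_pmf (P l b) \<subseteq> X" if "l \<in> L" "b \<in> {-1, 1}" for l b
    unfolding P_def X_def using sub[OF that(1)] that \<open>0 \<le> \<alpha>\<close> \<open>\<alpha> \<le> 1/2\<close>
    by (intro set_biased_pmf) (auto simp: abs_mult)
  have U_set: "set_pmf U = X"
    using finX X_ne by (simp add: U_def X_def set_pmf_of_set)
  \<comment> \<open>The deviation from uniform is a multiple of a character; its factor \<alpha> is
    the one in the final bound.\<close>
  have pmf_diff: "pmf (P l b) x - pmf U x = 2 * \<alpha> / N * (real_of_int b * w l x)"
    if "l \<in> L" "b \<in> {-1, 1}" "x \<in> X" for l b x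
  proof -
    have "pmf (P l b) x = (1 + 2 * (real_of_int b * \<alpha>) * w l x) / N"
      unfolding P_def using sub[OF that(1)] that \<open>0 \<le> \<alpha>\<close> \<open>\<alpha> \<le> 1/2\<close>
      by (subst pmf_biased_pmf) (auto simp: abs_mult X_def w_def N_def)
    moreover have "pmf U x = 1 / N"
      using that finX X_ne by (simp add: U_def X_def N_def)
    ultimately show ?thesis by (simp add: add_divide_distrib)
  qed
  have Z: "finite (set_pmf (replicate_pmf m (P l b)))"
    "set_pmf (replicate_pmf m (P l b)) \<subseteq> {zs. set zs \<subseteq> X \<and> length zs = m}"
    if "l \<in> L" "b \<in> {-1, 1}" for l b
  proof -
    show "finite (set_pmf (replicate_pmf m (P l b)))"
      by (intro finite_set_replicate_pmf finite_subset[OF P_sub[OF that] finX])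
    show "set_pmf (replicate_pmf m (P l b)) \<subseteq> {zs. set zs \<subseteq> X \<and> length zs = m}"
      using P_sub[OF that] by (auto simp: set_replicate_pmf)
  qed
  have g_eq: "g l b s = (\<Sum>zs\<in>set_pmf (replicate_pmf m (P l b)).
      pmf (replicate_pmf m (P l b)) zs * measure (output_from S M (Suc (Suc t)) zs s) {(l, b)})"
    if "l \<in> L" "b \<in> {-1, 1}" for l b s
    unfolding g_def using Z(1)[OF that] by (subst integral_measure_pmf) auto
  have out: "output_from S M (Suc (Suc t)) zs \<in> S \<rightarrow>\<^sub>M prob_algebra Q"
    if "l \<in> L" "b \<in> {-1, 1}" "zs \<in> set_pmf (replicate_pmf m (P l b))" for l b zs
    using Z(2)[OF that(1,2)] that(3) by (intro measurable_output_from[OF M']) auto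
  have meas_out: "(\<lambda>s. measure (output_from S M (Suc (Suc t)) zs s) {(l, b)}) \<in> borel_measurable S"
    if "l \<in> L" "b \<in> {-1, 1}" "zs \<in> set_pmf (replicate_pmf m (P l b))" for l b zs
    using out[OF that] h_sets[OF that(1,2)]
    by (rule measurable_compose[OF _ measurable_measure_prob_algebra])
  have out01: "measure (output_from S M (Suc (Suc t)) zs s) A \<le> 1"
    if "l \<in> L" "b \<in> {-1, 1}" "zs \<in> set_pmf (replicate_pmf m (P l b))" "s \<in> space S" for l b zs s A
    using measurable_space[OF out[OF that(1-3)] that(4)]
    by (intro prob_space.prob_le_1) (simp add: space_prob_algebra)
  have g_meas: "g l b \<in> borel_measurable S" if "l \<in> L" "b \<in> {-1, 1}" for l b
    unfolding g_eq[OF that, abs_def] using meas_out[OF that]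
    by (intro borel_measurable_sum borel_measurable_times) auto
  have g01: "0 \<le> g l b s \<and> g l b s \<le> 1" if "l \<in> L" "b \<in> {-1, 1}" "s \<in> space S" for l b s
  proof
    show "0 \<le> g l b s" by (simp add: g_def)
    show "g l b s \<le> 1"
      unfolding g_def using Z(1)[OF that(1,2)] out01[OF that(1,2) _ that(3)]
      by (intro measure_pmf.integral_le_const integrable_measure_pmf_finite)
         (auto simp: AE_measure_pmf_iff)
  qed
  have step: "(\<Sum>l\<in>L. \<Sum>b\<in>{-1,1}. \<Sum>x\<in>X. (pmf (P l b) x - pmf U x) *
      measure_pmf.expectation (replicate_pmf m (P l b)) (\<lambda>zs. F l b ((ys @ [x]) @ zs))) \<le> ?bound"
    if ys: "set ys \<subseteq> X" "length ys = t" for ys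
  proof -
    define K where "K x = internal_state S M (ys @ [x])" for x
    have K: "K x \<in> space (prob_algebra S)" if "x \<in> X" for x
      unfolding K_def using ys that by (intro internal_state_in_prob_algebra[OF M']) auto
    have intK: "integrable (K x) f" if "x \<in> X" "f \<in> borel_measurable S"
      "\<And>s. s \<in> space S \<Longrightarrow> \<bar>f s\<bar> \<le> 1" for x and f :: "'s \<Rightarrow> real"
    proof -
      interpret prob_space "K x" using K[OF that(1)] by (rule prob_algebraD)
      show ?thesis
        using that(2,3) prob_algebraD(3)[OF K[OF that(1)]]
          measurable_cong_sets[OF prob_algebraD(2)[OF K[OF that(1)]] refl, of borel]
        by (intro integrable_const_bound[of _ 1]) auto
    qed
    have exp_F: "measure_pmf.expectation (replicate_pmf m (P l b)) (\<lambda>zs. F l b ((ys @ [x]) @ zs))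
        = (\<integral>s. g l b s \<partial>K x)" if lb: "l \<in> L" "b \<in> {-1, 1}" and x: "x \<in> X" for l b x
    proof -
      let ?R = "replicate_pmf m (P l b)"
      have "measure_pmf.expectation ?R (\<lambda>zs. F l b ((ys @ [x]) @ zs))
          = (\<Sum>zs\<in>set_pmf ?R. pmf ?R zs * F l b ((ys @ [x]) @ zs))"
        using Z(1)[OF lb] by (subst integral_measure_pmf) auto
      also have "\<dots> = (\<Sum>zs\<in>set_pmf ?R. pmf ?R zs *
          (\<integral>s. measure (output_from S M (Suc (Suc t)) zs s) {(l, b)} \<partial>K x))"
      proof (intro sum.cong refl arg_cong2[where f = "(*)"])
        fix zs assume "zs \<in> set_pmf ?R"
        then have "set zs \<subseteq> X" using Z(2)[OF lb] by auto
        then show "F l b ((ys @ [x]) @ zs) = (\<integral>s. measure (output_from S M (Suc (Suc t)) zs s) {(l, b)} \<partial>K x)"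
          unfolding F_def K_def using ys x h_sets[OF lb]
          by (subst measure_alg_output_append[OF M']) auto
      qed
      also have "\<dots> = (\<integral>s. g l b s \<partial>K x)"
        unfolding g_eq[OF lb] using meas_out[OF lb] out01[OF lb] x
        by (subst Bochner_Integration.integral_sum) (auto intro!: integrable_mult_right intK)
      finally show ?thesis .
    qed
    have "(\<Sum>l\<in>L. \<Sum>b\<in>{-1,1}. \<Sum>x\<in>X. (pmf (P l b) x - pmf U x) *
        measure_pmf.expectation (replicate_pmf m (P l b)) (\<lambda>zs. F l b ((ys @ [x]) @ zs)))
      = (\<Sum>l\<in>L. \<Sum>b\<in>{-1,1}. \<Sum>x\<in>X. 2 * \<alpha> / N * (real_of_int b * w l x) * (\<integral>s. g l b s \<partial>K x))"
      by (intro sum.cong refl arg_cong2[where f = "(*)"] pmf_diff exp_F)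
    \<comment> \<open>The two signs weight the same character oppositely and merge into the test
      function \<open>g l 1 - g l (-1)\<close>. It is bounded by 1 because both terms lie in
      [0, 1].\<close>
    also have "\<dots> = (\<Sum>l\<in>L. \<Sum>x\<in>X. 2 * \<alpha> / N * (w l x * (\<integral>s. g l 1 s - g l (-1) s \<partial>K x)))"
    proof (intro sum.cong refl)
      fix l assume l: "l \<in> L"
      have diff: "(\<integral>s. g l 1 s - g l (-1) s \<partial>K x) = (\<integral>s. g l 1 s \<partial>K x) - (\<integral>s. g l (-1) s \<partial>K x)"
        if "x \<in> X" for x
        using that l g_meas g01 by (intro Bochner_Integration.integral_diff intK) auto
      have "(\<Sum>b\<in>{-1,1}. \<Sum>x\<in>X. 2 * \<alpha> / N * (real_of_int b * w l x) * (\<integral>s. g l b s \<partial>K x))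
        = (\<Sum>x\<in>X. 2 * \<alpha> / N * (w l x * ((\<integral>s. g l 1 s \<partial>K x) - (\<integral>s. g l (-1) s \<partial>K x))))"
        by (simp add: sum.distrib[symmetric] algebra_simps diff_divide_distrib)
      also have "\<dots> = (\<Sum>x\<in>X. 2 * \<alpha> / N * (w l x * (\<integral>s. g l 1 s - g l (-1) s \<partial>K x)))"
        by (intro sum.cong refl) (simp only: diff)
      finally show "(\<Sum>b\<in>{-1,1}. \<Sum>x\<in>X. 2 * \<alpha> / N * (real_of_int b * w l x) * (\<integral>s. g l b s \<partial>K x))
        = (\<Sum>x\<in>X. 2 * \<alpha> / N * (w l x * (\<integral>s. g l 1 s - g l (-1) s \<partial>K x)))" .
    qed
    also have "\<dots> = 2 * \<alpha> / N * (\<Sum>x\<in>X. \<Sum>l\<in>L. w l x * (\<integral>s. g l 1 s - g l (-1) s \<partial>K x))"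
      by (subst sum.swap) (simp add: sum_distrib_left)
    also have "\<dots> \<le> 2 * \<alpha> / N * (N * ((exp \<epsilon> - exp (- \<epsilon>)) / 2 * sqrt (real (card L)) + 2 * \<delta> * real (card L)))"
      unfolding N_def
    proof (intro mult_left_mono local_randomizer_correlation_le[where S = S])
      fix l l' assume "l \<in> L" "l' \<in> L"
      then show "(\<Sum>x\<in>X. w l x * w l' x) = (if l = l' then real (card X) else 0)"
        unfolding w_def X_def using L by (intro labelled_parity_char_orthogonal) auto
    next
      fix l assume "l \<in> L"
      then show "(\<Sum>x\<in>X. w l x) = 0"
        unfolding w_def X_def using sub by (intro sum_parity_char) auto
    next
      fix l x assume "l \<in> L" "x \<in> X"
      then show "\<bar>w l x\<bar> \<le> 1"
        unfolding w_def X_def using parity_char_cases[OF _ sub] by fastforce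
    next
      fix x y T assume "x \<in> X" "y \<in> X" "T \<in> sets S"
      then show "measure (K x) T \<le> exp \<epsilon> * measure (K y) T + \<delta>"
        unfolding K_def using ys \<open>t < n\<close> by (intro pan_private_internal_state[OF M' pp']) auto
    next
      fix l assume "l \<in> L"
      then show "(\<lambda>s. g l 1 s - g l (-1) s) \<in> borel_measurable S"
        using g_meas by (intro borel_measurable_diff) auto
    next
      fix l s assume "l \<in> L" "s \<in> space S"
      then show "\<bar>g l 1 s - g l (-1) s\<bar> \<le> 1"
        using g01[of l 1 s] g01[of l "-1" s] by auto
    qed (use finX X_ne finL K \<open>0 \<le> \<epsilon>\<close> \<open>0 \<le> \<delta>\<close> \<open>0 \<le> \<alpha>\<close> in auto)
    also have "\<dots> = ?bound" using N by simp
    finally show ?thesis .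
  qed
  have intU: "integrable (measure_pmf (replicate_pmf t U)) f" for f :: "(nat \<Rightarrow> int) list \<Rightarrow> real"
    using finX U_set by (intro integrable_measure_pmf_finite finite_set_replicate_pmf) auto
  have "(\<Sum>l\<in>L. \<Sum>b\<in>{-1,1}. hybrid U (P l b) n (F l b) t - hybrid U (P l b) n (F l b) (Suc t))
    = (\<Sum>l\<in>L. \<Sum>b\<in>{-1,1}. measure_pmf.expectation (replicate_pmf t U) (\<lambda>ys. \<Sum>x\<in>X. (pmf (P l b) x - pmf U x) *
      measure_pmf.expectation (replicate_pmf m (P l b)) (\<lambda>zs. F l b ((ys @ [x]) @ zs))))"
    unfolding m_def using U_set finX \<open>t < n\<close> P_sub by (intro sum.cong refl hybrid_diff) auto
  \<comment> \<open>The prefix law is common to all \<open>(l, b)\<close>, so the sums move inside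
    the expectation and the bound for each fixed prefix can be averaged.\<close>
  also have "\<dots> = measure_pmf.expectation (replicate_pmf t U) (\<lambda>ys. \<Sum>l\<in>L. \<Sum>b\<in>{-1,1}. \<Sum>x\<in>X. (pmf (P l b) x - pmf U x) *
      measure_pmf.expectation (replicate_pmf m (P l b)) (\<lambda>zs. F l b ((ys @ [x]) @ zs)))"
    by (simp only: Bochner_Integration.integral_sum[OF intU])
  also have "\<dots> \<le> ?bound"
    using step U_set
    by (intro measure_pmf.integral_le_const intU) (auto simp: AE_measure_pmf_iff set_replicate_pmf)
  finally show ?thesis .
qed

text \<open>On [0, 1], exp \<epsilon> is at most 1 + \<epsilon> + \<open>\<epsilon>\<^sup>2\<close>
  and hence at most 1 + 2 \<epsilon>, while exp (- \<epsilon>) is at least 1 - \<epsilon>.\<close>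

lemma exp_minus_exp_neg_le:
  fixes \<epsilon> :: real
  assumes "0 \<le> \<epsilon>" "\<epsilon> \<le> 1"
  shows "exp \<epsilon> - exp (- \<epsilon>) \<le> 3 * \<epsilon>"
proof -
  have "\<epsilon>\<^sup>2 \<le> \<epsilon>" using assms by (simp add: power2_eq_square mult_left_le)
  then show ?thesis using exp_bound[of \<epsilon>] exp_ge_add_one_self[of "- \<epsilon>"] assms by linarith
qed

text \<open>From \<delta> \<le> 1/2 and 1 \<le> K the logarithm is at least ln 2, hence at least
  1/2. With \<open>\<alpha>\<^sup>2 \<le> 1/4\<close> and
  \<open>\<epsilon>\<^sup>2 \<le> \<epsilon>\<close> this gives 2 \<delta> K \<le> \<epsilon>, so
  the additive privacy loss is of no larger order than the multiplicative one.\<close>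

lemma privacy_slack_le:
  fixes \<alpha> \<epsilon> \<delta> K :: real
  assumes "0 < \<alpha>" "\<alpha> < 1/2" "0 < \<epsilon>" "\<epsilon> \<le> 1" "0 \<le> \<delta>" "\<delta> \<le> 1/2" "1 \<le> K"
    and small: "\<delta> * ln (K / \<delta>) \<le> \<alpha>\<^sup>2 * \<epsilon>\<^sup>2 / K"
  shows "2 * \<delta> * K \<le> \<epsilon> * sqrt K"
proof (cases "\<delta> = 0")
  case False
  then have \<delta>: "0 < \<delta>" using assms by simp
  have "2 * \<delta> \<le> K" using assms by linarith
  then have "2 \<le> K / \<delta>" using \<delta> by (simp add: field_simps)
  then have "ln 2 \<le> ln (K / \<delta>)" by (intro ln_mono) auto
  then have "1/2 \<le> ln (K / \<delta>)" using ln2_ge_two_thirds by linarith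
  then have "\<delta> * (1/2) \<le> \<alpha>\<^sup>2 * \<epsilon>\<^sup>2 / K"
    using small \<delta> by (meson mult_left_mono less_imp_le order_trans)
  also have "\<dots> \<le> (1/4 * \<epsilon>) / K"
  proof (intro divide_right_mono mult_mono)
    show "\<alpha>\<^sup>2 \<le> 1/4" using power_mono[of \<alpha> "1/2" 2] assms by (simp add: power2_eq_square)
    show "\<epsilon>\<^sup>2 \<le> \<epsilon>" using assms by (simp add: power2_eq_square mult_left_le)
  qed (use assms in auto)
  finally have "2 * \<delta> * K \<le> \<epsilon>" using assms by (simp add: field_simps)
  also have "\<dots> \<le> \<epsilon> * sqrt K" using assms by simp
  finally show ?thesis .
qed (use assms in auto)

text \<open>Over the 2 K hypotheses, the probabilities of emitting the right one sum to at least 2 K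
  * 99/100 on biased data and to at most 1 on uniform data. Each of the n hybrid steps accounts for
  at most 5 \<alpha> \<epsilon> \<open>sqrt K\<close> of the difference.\<close>

lemma pan_private_parity_bound:
  fixes M :: "(nat \<Rightarrow> int, 's, nat set \<times> int) online_alg"
  assumes "1 \<le> k" "k \<le> d" "0 < \<alpha>" "\<alpha> < 1/2" "0 < \<epsilon>" "\<epsilon> \<le> 1" "0 \<le> \<delta>" "\<delta> \<le> 1/2" "1 \<le> n"
    and M: "online_algorithm (data_domain d) S (count_space (signed_parities d)) M"
    and pp: "pan_private (data_domain d) S (count_space (signed_parities d)) n \<epsilon> \<delta> M"
    and learns: "learns_parities d k \<alpha> n (alg_output S M)"
    and small: "\<delta> * ln (real (binom_le d k) / \<delta>) \<le> \<alpha>\<^sup>2 * \<epsilon>\<^sup>2 / real (binom_le d k)"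
  shows "1/10 * sqrt (real (binom_le d k)) / (\<alpha> * \<epsilon>) \<le> real n"
proof -
  define L where "L = {l. l \<subseteq> {1..d} \<and> 1 \<le> card l \<and> card l \<le> k}"
  define K where "K = real (card L)"
  define U where "U = pmf_of_set (data_domain d)"
  define P where "P l b = biased_pmf d (insert (d+1) l) (real_of_int b * \<alpha>)" for l b
  define F where "F l b xs = measure (alg_output S M xs) {(l, b)}" for l and b :: int and xs
  let ?Q = "count_space (signed_parities d)"
  have K_eq: "K = real (binom_le d k)"
    by (simp only: K_def L_def card_subsets_binom_le)
  have L_sub: "L \<subseteq> Pow {1..d}" by (auto simp: L_def)
  then have finL: "finite L" by (rule finite_subset) simp
  have "{1} \<in> L" using assms by (simp add: L_def)
  then have K1: "1 \<le> K" using finL card_gt_0_iff[of L] by (auto simp: K_def)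
  have prob: "prob_space (alg_output S M xs)" "sets (alg_output S M xs) = sets ?Q"
    "space (alg_output S M xs) = space ?Q" if "set xs \<subseteq> data_domain d" "length xs = n" for xs
  proof -
    have "xs \<noteq> []" using that(2) \<open>1 \<le> n\<close> by auto
    from prob_algebraD[OF alg_output_in_prob_algebra[OF M that(1) this]]
    show "prob_space (alg_output S M xs)" "sets (alg_output S M xs) = sets ?Q"
      "space (alg_output S M xs) = space ?Q" .
  qed
  \<comment> \<open>Under \<open>P l b\<close> the only possible good output is
    \<open>(l, b)\<close>, so the success probability bounds the probability of emitting this
    pair.\<close>
  have start: "99/100 \<le> hybrid U (P l b) n (F l b) 0" if l: "l \<in> L" and b: "b \<in> {-1, 1}" for l b
  proof -
    have sub: "set_pmf (P l b) \<subseteq> data_domain d"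
      unfolding P_def using l b assms by (intro set_biased_pmf) (auto simp: L_def abs_mult)
    let ?good = "{h \<in> signed_parities d. parity_err d (P l b) h < opt_err d k (P l b) + \<alpha>}"
    have fin: "finite (set_pmf (replicate_pmf n (P l b)))"
      using sub finite_data_domain by (intro finite_set_replicate_pmf) (rule finite_subset)
    have "99/100 \<le> measure_pmf.expectation (replicate_pmf n (P l b)) (\<lambda>xs. measure (alg_output S M xs) ?good)"
      using learns sub unfolding learns_parities_def by blast
    also have "\<dots> \<le> measure_pmf.expectation (replicate_pmf n (P l b)) (F l b)"
    proof (intro integral_mono_AE integrable_measure_pmf_finite fin)
      show "AE xs in measure_pmf (replicate_pmf n (P l b)). measure (alg_output S M xs) ?good \<le> F l b xs"
        unfolding AE_measure_pmf_iff set_replicate_pmf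
      proof
        fix xs assume "xs \<in> {xs \<in> lists (set_pmf (P l b)). length xs = n}"
        then have xs: "set xs \<subseteq> data_domain d" "length xs = n" using sub by auto
        interpret prob_space "alg_output S M xs" by (rule prob[OF xs])
        have "?good \<subseteq> {(l, b)}"
          unfolding P_def using l b assms by (intro near_optimal_biased_pmf) (auto simp: L_def)
        moreover have "{(l, b)} \<in> sets (alg_output S M xs)"
          using l b unfolding prob[OF xs] by (auto simp: L_def signed_parities_def)
        ultimately show "measure (alg_output S M xs) ?good \<le> F l b xs"
          unfolding F_def by (rule finite_measure_mono)
      qed
    qed
    finally show ?thesis by (simp add: hybrid_0)
  qed
  \<comment> \<open>Uniform data do not depend on \<open>(l, b)\<close>, so the summands are
    probabilities of disjoint events under one output law.\<close>
  have stop: "(\<Sum>l\<in>L. \<Sum>b\<in>{-1,1}. hybrid U (P l b) n (F l b) n) \<le> 1"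
  proof -
    have U: "set_pmf U = data_domain d"
      by (simp add: U_def finite_data_domain data_domain_nonempty)
    have int: "integrable (measure_pmf (replicate_pmf n U)) f" for f :: "(nat \<Rightarrow> int) list \<Rightarrow> real"
      by (intro integrable_measure_pmf_finite finite_set_replicate_pmf) (simp add: U finite_data_domain)
    have "(\<Sum>l\<in>L. \<Sum>b\<in>{-1,1}. hybrid U (P l b) n (F l b) n)
        = measure_pmf.expectation (replicate_pmf n U) (\<lambda>xs. \<Sum>l\<in>L. \<Sum>b\<in>{-1,1}. F l b xs)"
      by (simp only: hybrid_self Bochner_Integration.integral_sum[OF int])
    also have "\<dots> \<le> 1"
    proof (intro measure_pmf.integral_le_const int, unfold AE_measure_pmf_iff set_replicate_pmf U, intro ballI)
      fix xs assume "xs \<in> {xs \<in> lists (data_domain d). length xs = n}"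
      then have xs: "set xs \<subseteq> data_domain d" "length xs = n" by auto
      interpret prob_space "alg_output S M xs" by (rule prob[OF xs])
      have sub: "L \<times> {-1, 1} \<subseteq> signed_parities d"
        using L_sub by (auto simp: signed_parities_def)
      have "(\<Sum>l\<in>L. \<Sum>b\<in>{-1,1}. F l b xs) = (\<Sum>h\<in>L \<times> {-1,1}. prob {h})"
        unfolding F_def by (simp only: sum.cartesian_product case_prod_unfold prod.collapse)
      also have "\<dots> = prob (L \<times> {-1, 1})"
        using sub finL by (intro measure_eq_sum_singleton[symmetric]) (auto simp: prob[OF xs])
      also have "\<dots> \<le> 1" by (rule prob_le_1)
      finally show "(\<Sum>l\<in>L. \<Sum>b\<in>{-1,1}. F l b xs) \<le> 1" .
    qed
    finally show ?thesis .
  qed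
  let ?B = "2 * \<alpha> * ((exp \<epsilon> - exp (- \<epsilon>)) / 2 * sqrt K + 2 * \<delta> * K)"
  have "99/100 * (2 * K) = (\<Sum>l\<in>L. \<Sum>b\<in>{-1,1::int}. 99/100)"
    by (simp add: K_def)
  also have "\<dots> \<le> (\<Sum>l\<in>L. \<Sum>b\<in>{-1,1}. hybrid U (P l b) n (F l b) 0)"
    by (intro sum_mono start)
  also have "\<dots> = (\<Sum>l\<in>L. \<Sum>b\<in>{-1,1}. hybrid U (P l b) n (F l b) n
      + (\<Sum>t<n. hybrid U (P l b) n (F l b) t - hybrid U (P l b) n (F l b) (Suc t)))"
    by (simp only: sum_lessThan_telescope') simp
  also have "\<dots> = (\<Sum>l\<in>L. \<Sum>b\<in>{-1,1}. hybrid U (P l b) n (F l b) n)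
      + (\<Sum>l\<in>L. \<Sum>b\<in>{-1,1}. \<Sum>t<n. hybrid U (P l b) n (F l b) t - hybrid U (P l b) n (F l b) (Suc t))"
    by (simp only: sum.distrib)
  also have "(\<Sum>l\<in>L. \<Sum>b\<in>{-1,1}. \<Sum>t<n. hybrid U (P l b) n (F l b) t - hybrid U (P l b) n (F l b) (Suc t))
      = (\<Sum>t<n. \<Sum>l\<in>L. \<Sum>b\<in>{-1,1}. hybrid U (P l b) n (F l b) t - hybrid U (P l b) n (F l b) (Suc t))"
    by (simp only: sum.swap[of _ "{..<n}"])
  also have "\<dots> \<le> (\<Sum>t<n. ?B)"
    unfolding K_def U_def P_def F_def using assms L_sub M pp by (intro sum_mono hybrid_step_le) auto
  also note stop
  finally have gap: "99/100 * (2 * K) \<le> 1 + real n * ?B" by simp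
  \<comment> \<open>The exponential difference contributes 3/2 and the \<delta> term 1; the
    prefactor 2 makes this 5.\<close>
  have "?B \<le> 2 * \<alpha> * (3 * \<epsilon> / 2 * sqrt K + \<epsilon> * sqrt K)"
    using assms K1 exp_minus_exp_neg_le[of \<epsilon>] privacy_slack_le[of \<alpha> \<epsilon> \<delta> K]
    by (intro mult_left_mono add_mono mult_right_mono divide_right_mono) (auto simp: K_eq)
  also have "\<dots> = 5 * \<alpha> * \<epsilon> * sqrt K" by (simp add: algebra_simps)
  finally have "real n * ?B \<le> real n * (5 * \<alpha> * \<epsilon> * sqrt K)"
    by (rule mult_left_mono) simp
  with gap have "99/100 * (2 * K) \<le> 1 + real n * (5 * \<alpha> * \<epsilon> * sqrt K)" by linarith
  \<comment> \<open>As 1 \<le> K, the additive 1 is absorbed: 99/50 K - 1 is at least K/2.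
    Cancelling one \<open>sqrt K\<close> then gives the constant 1/10.\<close>
  then have "1/2 * K \<le> real n * (5 * \<alpha> * \<epsilon> * sqrt K)" using K1 by linarith
  then have "sqrt K * sqrt K \<le> (10 * (real n * \<alpha> * \<epsilon>)) * sqrt K" using K1 by (simp add: algebra_simps)
  then have "sqrt K \<le> 10 * (real n * \<alpha> * \<epsilon>)"
    by (rule mult_right_le_imp_le) (use K1 in simp)
  then show ?thesis using assms by (simp add: K_eq[symmetric] field_simps)
qed

text \<open>\<epsilon> \<le> 1 makes exp \<epsilon> - exp (- \<epsilon>) linear in \<epsilon>,
  \<delta> \<le> 1/2 keeps the logarithm away from zero, and 1 \<le> n ensures that there is a state
  to output from.\<close>

theorem theorem8p7:
  shows "\<exists>c>0. \<exists>C>0. \<forall>(d::nat) (k::nat) (\<alpha>::real) (\<epsilon>::real) (\<delta>::real) (n::nat)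
      (S :: 's measure) (M :: (nat \<Rightarrow> int, 's, nat set \<times> int) online_alg).
    1 \<le> k \<longrightarrow> k \<le> d \<longrightarrow> 0 < \<alpha> \<longrightarrow> \<alpha> < 1/2 \<longrightarrow>
    0 < \<epsilon> \<longrightarrow> \<epsilon> \<le> 1 \<longrightarrow> 0 \<le> \<delta> \<longrightarrow> \<delta> \<le> 1/2 \<longrightarrow> 1 \<le> n \<longrightarrow>
    online_algorithm (data_domain d) S (count_space (signed_parities d)) M \<longrightarrow>
    pan_private (data_domain d) S (count_space (signed_parities d)) n \<epsilon> \<delta> M \<longrightarrow>
    learns_parities d k \<alpha> n (alg_output S M) \<longrightarrow>
    \<delta> * ln (real (binom_le d k) / \<delta>) \<le> c * \<alpha>\<^sup>2 * \<epsilon>\<^sup>2 / real (binom_le d k) \<longrightarrow>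
    real n \<ge> C * sqrt (real (binom_le d k)) / (\<alpha> * \<epsilon>)"
  \<comment> \<open>The witnesses c = 1 and C = 1/10 are numerals, hence the same for every type of
    states.\<close>
  using pan_private_parity_bound by (intro exI[of _ 1] exI[of _ "1/10"] conjI allI impI) auto

end
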